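(* For any positive integer $d$ there is an instance of the Simultaneous Item First Price Auction in which all bidders have valuations in $\mathrm{SAW}\text{-}d$, and whose price of anarchy is at least $d+1/(d+1)$.
   Context: Valuations are normalized monotone set functions $f:2^{[m]}\to\mathbb{R}_{\ge0}$ over the item set $[m]$. Write $f(S\mid T)=f(S\cup T)-f(T)$. A set $T$ is superadditive w.r.t. $f$ if there exists $S\subseteq[m]\setminus T$ with $f(S\mid T)>\max_{T'\subsetneq T} f(S\mid T')$; $\mathrm{SAW}(f)$ is the maximum cardinality of a nonempty superadditive set (0 if none), and $\mathrm{SAW}\text{-}d$ is the class of $f$ with $\mathrm{SAW}(f)\le d$. Simultaneous Item First Price Auction: each bidder bids on every item; each item goes to its highest bidder, who pays its bid on that item. The price of anarchy is the ratio of the optimal social welfare to the welfare of the worst equilibrium. *)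

theory Defs
  imports "HOL-Probability.Probability"
begin

section \<open>Valuations and superadditive width\<close>

text \<open>The item set is \<open>{..<m}\<close>; only the values of a set function on subsets of it matter.\<close>

definition valuation :: "nat \<Rightarrow> (nat set \<Rightarrow> real) \<Rightarrow> bool" where
  "valuation m f \<longleftrightarrow> f {} = 0 \<and> (\<forall>S\<subseteq>{..<m}. 0 \<le> f S) \<and>
     (\<forall>S T. S \<subseteq> T \<and> T \<subseteq> {..<m} \<longrightarrow> f S \<le> f T)"

definition marginal :: "(nat set \<Rightarrow> real) \<Rightarrow> nat set \<Rightarrow> nat set \<Rightarrow> real" where
  "marginal f S T = f (S \<union> T) - f T"

text \<open>Only used for nonempty \<open>T\<close>, where the maximum ranges over a finite nonempty set.\<close>

definition superadditive_set :: "nat \<Rightarrow> (nat set \<Rightarrow> real) \<Rightarrow> nat set \<Rightarrow> bool" where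
  "superadditive_set m f T \<longleftrightarrow> T \<subseteq> {..<m} \<and>
     (\<exists>S \<subseteq> {..<m} - T. marginal f S T > Max (marginal f S ` {T'. T' \<subset> T}))"

definition SAW :: "nat \<Rightarrow> (nat set \<Rightarrow> real) \<Rightarrow> nat" where
  "SAW m f = Max (insert 0 (card ` {T. T \<noteq> {} \<and> superadditive_set m f T}))"

definition SAW_class :: "nat \<Rightarrow> nat \<Rightarrow> (nat set \<Rightarrow> real) set" where
  "SAW_class m d = {f. valuation m f \<and> SAW m f \<le> d}"

section \<open>Simultaneous item first price auction\<close>

text \<open>Bidders are \<open>{..<n}\<close>; in a bid profile \<open>b\<close>, bidder \<open>i\<close> bids \<open>b i j\<close> on item \<open>j\<close>.
  An assignment maps each item to the bidder receiving it.\<close>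

abbreviation bid_space :: "nat \<Rightarrow> (nat \<Rightarrow> real) measure" where
  "bid_space m \<equiv> Pi\<^sub>M {..<m} (\<lambda>_. borel)"

abbreviation profile_space :: "nat \<Rightarrow> nat \<Rightarrow> (nat \<Rightarrow> nat \<Rightarrow> real) measure" where
  "profile_space n m \<equiv> Pi\<^sub>M {..<n} (\<lambda>_. bid_space m)"

definition bundle_of :: "nat \<Rightarrow> (nat \<Rightarrow> nat) \<Rightarrow> nat \<Rightarrow> nat set" where
  "bundle_of m a i = {j. j < m \<and> a j = i}"

definition welfare :: "nat \<Rightarrow> nat \<Rightarrow> (nat \<Rightarrow> nat set \<Rightarrow> real) \<Rightarrow> (nat \<Rightarrow> nat) \<Rightarrow> real" where
  "welfare n m v a = (\<Sum>i<n. v i (bundle_of m a i))"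

definition optimal_welfare :: "nat \<Rightarrow> nat \<Rightarrow> (nat \<Rightarrow> nat set \<Rightarrow> real) \<Rightarrow> real" where
  "optimal_welfare n m v = Max (welfare n m v ` ({..<m} \<rightarrow>\<^sub>E {..<n}))"

text \<open>An allocation rule \<open>w\<close> sends a bid profile to an assignment giving every item to one of its
  highest bidders; the choice of \<open>w\<close> is exactly the choice of how ties are broken.
  Measurability makes expectations over randomized bids meaningful.\<close>

definition highest_bid_rule ::
  "nat \<Rightarrow> nat \<Rightarrow> ((nat \<Rightarrow> nat \<Rightarrow> real) \<Rightarrow> nat \<Rightarrow> nat) \<Rightarrow> bool" where
  "highest_bid_rule n m w \<longleftrightarrow>
     (\<forall>j<m. (\<lambda>b. w b j) \<in> profile_space n m \<rightarrow>\<^sub>M count_space UNIV) \<and>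
     (\<forall>b \<in> space (profile_space n m). \<forall>j<m.
        w b j < n \<and> (\<forall>i<n. b i j \<le> b (w b j) j))"

definition utility ::
  "nat \<Rightarrow> (nat \<Rightarrow> nat set \<Rightarrow> real) \<Rightarrow> ((nat \<Rightarrow> nat \<Rightarrow> real) \<Rightarrow> nat \<Rightarrow> nat) \<Rightarrow> nat
     \<Rightarrow> (nat \<Rightarrow> nat \<Rightarrow> real) \<Rightarrow> real" where
  "utility m v w i b = v i (bundle_of m (w b) i) - (\<Sum>j\<in>bundle_of m (w b) i. b i j)"

definition mixed_strategy :: "nat \<Rightarrow> (nat \<Rightarrow> real) measure \<Rightarrow> bool" where
  "mixed_strategy m \<tau> \<longleftrightarrow> prob_space \<tau> \<and> sets \<tau> = sets (bid_space m) \<and>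
     (AE x in \<tau>. \<forall>j<m. 0 \<le> x j)"

text \<open>Mixed Nash equilibrium of the full-information game. Bidders randomize independently, hence
  the product measure. A bidder whose utility is not integrable has expected utility minus
  infinity (values are bounded, payments are nonnegative) and would rather bid zero, so the
  integrability clause excludes no equilibrium; it is needed because the Bochner
  integral of a non-integrable function is 0. Utilities after a deviation to a fixed bid vector
  are bounded, hence always integrable.\<close>

definition nash_equilibrium ::
  "nat \<Rightarrow> nat \<Rightarrow> (nat \<Rightarrow> nat set \<Rightarrow> real) \<Rightarrow> ((nat \<Rightarrow> nat \<Rightarrow> real) \<Rightarrow> nat \<Rightarrow> nat)
     \<Rightarrow> (nat \<Rightarrow> (nat \<Rightarrow> real) measure) \<Rightarrow> bool" where
  "nash_equilibrium n m v w \<sigma> \<longleftrightarrow>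
     (\<forall>i<n. mixed_strategy m (\<sigma> i)) \<and>
     (\<forall>i<n. integrable (Pi\<^sub>M {..<n} \<sigma>) (utility m v w i)) \<and>
     (\<forall>i<n. \<forall>x \<in> space (bid_space m). (\<forall>j<m. 0 \<le> x j) \<longrightarrow>
        (\<integral>b. utility m v w i (b(i := x)) \<partial>(Pi\<^sub>M {..<n} \<sigma>))
          \<le> (\<integral>b. utility m v w i b \<partial>(Pi\<^sub>M {..<n} \<sigma>)))"

definition expected_welfare ::
  "nat \<Rightarrow> nat \<Rightarrow> (nat \<Rightarrow> nat set \<Rightarrow> real) \<Rightarrow> ((nat \<Rightarrow> nat \<Rightarrow> real) \<Rightarrow> nat \<Rightarrow> nat)
     \<Rightarrow> (nat \<Rightarrow> (nat \<Rightarrow> real) measure) \<Rightarrow> real" where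
  "expected_welfare n m v w \<sigma> = (\<integral>b. welfare n m v (w b) \<partial>(Pi\<^sub>M {..<n} \<sigma>))"

text \<open>In \<^typ>\<open>ereal\<close>, a positive optimum divided by worst-case welfare 0 is \<open>\<infinity>\<close>, \<open>0 / 0 = 0\<close>,
  and the ratio is 0 if there is no equilibrium.\<close>

definition price_of_anarchy ::
  "nat \<Rightarrow> nat \<Rightarrow> (nat \<Rightarrow> nat set \<Rightarrow> real) \<Rightarrow> ((nat \<Rightarrow> nat \<Rightarrow> real) \<Rightarrow> nat \<Rightarrow> nat) \<Rightarrow> ereal" where
  "price_of_anarchy n m v w = ereal (optimal_welfare n m v) /
     (INF \<sigma> \<in> {\<sigma>. nash_equilibrium n m v w \<sigma>}. ereal (expected_welfare n m v w \<sigma>))"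

text \<open>Breaking ties in favour of the smallest index is an admissible rule.\<close>

lemma highest_bid_rule_exists:
  assumes "n > 0"
  shows "highest_bid_rule n m (\<lambda>b j. LEAST i. i < n \<and> (\<forall>i'<n. b i' j \<le> b i j))"
  unfolding highest_bid_rule_def
proof (intro conjI allI impI ballI)
  fix j assume j: "j < m"
  have comp: "(\<lambda>b. b i j) \<in> borel_measurable (profile_space n m)" if "i < n" for i
  proof -
    have "(\<lambda>b. b i) \<in> profile_space n m \<rightarrow>\<^sub>M bid_space m"
      using that by (intro measurable_component_singleton) auto
    moreover have "(\<lambda>x. x j) \<in> bid_space m \<rightarrow>\<^sub>M borel"
      using j by (intro measurable_component_singleton) auto
    ultimately show ?thesis by (rule measurable_compose)
  qed
  have "Measurable.pred (profile_space n m) (\<lambda>b. i < n \<and> (\<forall>i'<n. b i' j \<le> b i j))" for i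
  proof (cases "i < n")
    case True
    have "Measurable.pred (profile_space n m) (\<lambda>b. \<forall>i'\<in>{..<n}. b i' j \<le> b i j)"
    proof (rule pred_intros_finite(3))
      fix i' assume "i' \<in> {..<n}"
      then have "i' < n" by simp
      show "Measurable.pred (profile_space n m) (\<lambda>b. b i' j \<le> b i j)"
        unfolding pred_def by (rule borel_measurable_le[OF comp[OF \<open>i' < n\<close>] comp[OF True]])
    qed simp
    then show ?thesis using True by (simp only: lessThan_iff Ball_def simp_thms)
  next
    case False
    then show ?thesis by (simp only: simp_thms measurable_const UNIV_I space_count_space)
  qed
  then show "(\<lambda>b. LEAST i. i < n \<and> (\<forall>i'<n. b i' j \<le> b i j))
      \<in> profile_space n m \<rightarrow>\<^sub>M count_space UNIV"
    by (rule measurable_Least[where P = "\<lambda>i b. i < n \<and> (\<forall>i'<n. b i' j \<le> b i j)"])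
next
  fix b :: "nat \<Rightarrow> nat \<Rightarrow> real" and j
  have "finite ((\<lambda>i. b i j) ` {..<n})" "(\<lambda>i. b i j) ` {..<n} \<noteq> {}"
    using assms by auto
  from Max_in[OF this] obtain i0 where "i0 < n" "b i0 j = Max ((\<lambda>i. b i j) ` {..<n})"
    by auto
  then have *: "i0 < n \<and> (\<forall>i'<n. b i' j \<le> b i0 j)" by simp
  let ?i = "LEAST i. i < n \<and> (\<forall>i'<n. b i' j \<le> b i j)"
  have L: "?i < n \<and> (\<forall>i'<n. b i' j \<le> b ?i j)"
    by (rule LeastI[where P = "\<lambda>i. i < n \<and> (\<forall>i'<n. b i' j \<le> b i j)", OF *])
  show "?i < n" using L by blast
  fix i assume "i < n"
  then show "b i j \<le> b ?i j" using L by blast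
qed

end

theory Submission
  imports Defs
begin

text \<open>
  Put \<open>k = d + 1\<close> and arrange \<open>k * k\<close> items in a square grid, item \<open>c * k + r\<close> lying in column
  \<open>c\<close> and row \<open>r\<close>. Bidder 0 has value 1 for every set meeting all columns, bidder 1 has value 1
  for every set containing some column, and bidder \<open>c + 2\<close> has value 1 for column \<open>c\<close>. The minimal
  sets of positive value have \<open>k\<close> elements, so all valuations are in SAW-d. Giving column \<open>c\<close> to
  bidder \<open>c + 2\<close> yields welfare \<open>k\<close>.

  In equilibrium bidder 0 bids a random amount \<open>X\<close> on a uniformly random row, bidder 1 bids \<open>Y\<close> on a
  uniformly random column, where \<open>X\<close> and \<open>Y\<close> have distribution function \<open>F t = (k - 1) * t / (1 - t)\<close>
  on \<open>[0, 1/k]\<close>, and everybody else bids 0. The row and the column meet in one item, so exactly one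
  of the bidders 0 and 1 succeeds and the welfare is 1. A bidder trying to obtain a column at prices
  \<open>z r\<close> faces the price \<open>X\<close> on one random item and price 0 elsewhere; the identity
  \<open>F t * (1 - t) = (k - 1) * t\<close> makes the expected profit at most 0, with equality on
  \<open>[0, 1/k]\<close>. Transposing the grid, the same computation applies to bidder 0. Since \<open>F\<close> is
  continuous, relevant ties have probability 0 and the tie breaking rule is immaterial.
\<close>

section \<open>Zero-one valuations\<close>

definition contains_member :: "nat set set \<Rightarrow> nat set \<Rightarrow> real" where
  "contains_member \<A> S = of_bool (\<exists>A\<in>\<A>. A \<subseteq> S)"

text \<open>If \<open>S\<close> witnesses that \<open>T\<close> is superadditive, then adding
  \<open>S\<close> to \<open>T\<close> completes some member \<open>A\<close>. Already
  \<open>T \<inter> A\<close> together with \<open>S\<close> contains \<open>A\<close>, so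
  strictness over proper subsets forces \<open>T \<subseteq> A\<close>. As \<open>T\<close> itself
  contains no member, the inclusion is proper and
  \<open>card T < card A \<le> Suc d\<close>.\<close>

lemma contains_member_SAW_class:
  assumes ne: "{} \<notin> \<A>"
    and fin: "\<And>A. A \<in> \<A> \<Longrightarrow> finite A"
    and card: "\<And>A. A \<in> \<A> \<Longrightarrow> card A \<le> Suc d"
  shows "contains_member \<A> \<in> SAW_class m d"
proof -
  let ?f = "contains_member \<A>"
  have mono: "?f S \<le> ?f T" if "S \<subseteq> T" for S T
    using that by (auto simp: contains_member_def)
  have val: "valuation m ?f"
    using ne mono by (auto simp: valuation_def contains_member_def)
  have bound: "card T \<le> d" if sa: "superadditive_set m ?f T" and nonempty: "T \<noteq> {}" for T
  proof -
    from sa obtain S where T: "T \<subseteq> {..<m}"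
      and gt: "marginal ?f S T > Max (marginal ?f S ` {T'. T' \<subset> T})"
      by (auto simp: superadditive_set_def)
    have "finite T" using T finite_subset by blast
    then have "finite {T'. T' \<subset> T}"
      by (auto intro: finite_subset[of _ "Pow T"])
    then have less: "marginal ?f S T' < marginal ?f S T" if "T' \<subset> T" for T'
      using that by (intro le_less_trans[OF Max_ge gt]) auto
    have "marginal ?f S {} < marginal ?f S T"
      using less nonempty by blast
    moreover have "0 \<le> marginal ?f S {}"
      using mono[of "{}" S] ne by (auto simp: marginal_def contains_member_def)
    ultimately have pos: "marginal ?f S T > 0" by linarith
    then obtain A where A: "A \<in> \<A>" "A \<subseteq> S \<union> T" and noT: "\<not> (\<exists>A\<in>\<A>. A \<subseteq> T)"
      by (auto simp: marginal_def contains_member_def of_bool_def split: if_splits)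
    have "T \<subseteq> A"
    proof (rule ccontr)
      assume "\<not> T \<subseteq> A"
      then have "T \<inter> A \<subset> T" by blast
      from less[OF this] have "marginal ?f S (T \<inter> A) < marginal ?f S T" .
      moreover have "marginal ?f S (T \<inter> A) = 1"
        using A noT by (auto simp: marginal_def contains_member_def)
      moreover have "marginal ?f S T \<le> 1"
        by (auto simp: marginal_def contains_member_def)
      ultimately show False by simp
    qed
    moreover have "T \<noteq> A" using noT A by blast
    ultimately have "card T < card A"
      using fin[OF A(1)] by (simp add: psubset_card_mono psubsetI)
    then show ?thesis using card[OF A(1)] by simp
  qed
  have "finite {T. T \<noteq> {} \<and> superadditive_set m ?f T}"
    by (rule finite_subset[of _ "Pow {..<m}"]) (auto simp: superadditive_set_def)
  then have "SAW m ?f \<le> d"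
    unfolding SAW_def using bound by (subst Max_le_iff) auto
  with val show ?thesis by (simp add: SAW_class_def)
qed

section \<open>Random bid levels\<close>

text \<open>Integrate coordinate \<open>i\<close> first with coordinate \<open>j\<close> held fixed;
  the remaining coordinates only average nonpositive inner integrals. In the applications
  \<open>i\<close> is the opponent whose randomness is exploited, and the bound for almost every
  \<open>x\<close> allows for bids of \<open>j\<close> whose shape is known only up to null
  sets.\<close>

lemma integral_PiM_pair_nonpos:
  fixes G :: "'a \<Rightarrow> 'a \<Rightarrow> real"
  assumes ps: "\<And>i. prob_space (M i)"
    and I: "finite I" "i \<in> I" "j \<in> I" "i \<noteq> j"
    and int: "integrable (Pi\<^sub>M I M) (\<lambda>b. G (b i) (b j))"
    and le: "AE x in M j. (\<integral>y. G y x \<partial>M i) \<le> 0"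
  shows "(\<integral>b. G (b i) (b j) \<partial>Pi\<^sub>M I M) \<le> 0"
proof -
  interpret product_prob_space M I
    using ps by (simp add: product_prob_space_def product_sigma_finite_def
        product_prob_space_axioms_def prob_space_imp_sigma_finite)
  have Ii: "insert i (I - {i}) = I" using I by auto
  have "(\<integral>b. G (b i) (b j) \<partial>Pi\<^sub>M I M) = (\<integral>b. (\<integral>y. G y (b j) \<partial>M i) \<partial>Pi\<^sub>M (I - {i}) M)"
    using product_integral_insert[of "I - {i}" i "\<lambda>b. G (b i) (b j)"] I int Ii by simp
  also have "\<dots> \<le> 0"
  proof -
    have "AE b in Pi\<^sub>M (I - {i}) M. (\<integral>y. G y (b j) \<partial>M i) \<le> 0"
      using I by (intro AE_PiM_component[of "I - {i}" M j, OF ps _ le]) auto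
    then have "0 \<le> (\<integral>b. - (\<integral>y. G y (b j) \<partial>M i) \<partial>Pi\<^sub>M (I - {i}) M)"
      by (intro integral_nonneg_AE) auto
    then show ?thesis by simp
  qed
  finally show ?thesis .
qed

text \<open>If \<open>f\<close> is not integrable, its Bochner integral is 0 and obeys the bound as
  well. An integrable majorant therefore suffices to control the utility after a deviation.\<close>

lemma integral_nonpos_AE_bound:
  fixes f g :: "'a \<Rightarrow> real"
  assumes "integrable M g" "AE x in M. f x \<le> g x" "(\<integral>x. g x \<partial>M) \<le> 0"
  shows "(\<integral>x. f x \<partial>M) \<le> 0"
proof (cases "integrable M f")
  case True
  then show ?thesis using integral_mono_AE[OF True assms(1,2)] assms(3) by linarith
next
  case False
  then show ?thesis by (simp add: not_integrable_integral_eq)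
qed

text \<open>This is the quantile function of \<open>F\<close>.\<close>

definition level_bid :: "nat \<Rightarrow> real \<Rightarrow> real" where
  "level_bid k u = u / (real k - 1 + u)"

abbreviation unif :: "real measure" where
  "unif \<equiv> uniform_measure lborel {0<..1}"

lemma prob_space_unif: "prob_space unif"
  by (rule prob_space_uniform_measure) auto

lemma AE_unif: "AE u in unif. 0 < u \<and> u \<le> 1"
  by (rule AE_uniform_measureI) auto

lemma level_bid_measurable [measurable]: "level_bid k \<in> borel_measurable borel"
  unfolding level_bid_def by measurable

lemma level_bid_bounds:
  assumes "k \<ge> 2" "0 < u" "u \<le> 1"
  shows "0 < level_bid k u" "level_bid k u \<le> 1 / real k"
proof -
  have k: "real k \<ge> 2" using assms by simp
  then show "0 < level_bid k u" using assms by (simp add: level_bid_def)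
  have "u * real k \<le> real k - 1 + u"
    using mult_nonneg_nonneg[of "real k - 1" "1 - u"] k assms by (simp add: algebra_simps)
  then show "level_bid k u \<le> 1 / real k" using k assms by (simp add: level_bid_def field_simps)
qed

lemma level_bid_le_iff:
  assumes "k \<ge> 2" "0 < u" "t < 1"
  shows "level_bid k u \<le> t \<longleftrightarrow> u \<le> (real k - 1) * t / (1 - t)"
proof -
  have pos: "real k - 1 + u > 0" "1 - t > 0" using assms by auto
  have "level_bid k u \<le> t \<longleftrightarrow> u \<le> t * (real k - 1 + u)"
    unfolding level_bid_def by (rule pos_divide_le_eq[OF pos(1)])
  also have "\<dots> \<longleftrightarrow> u * (1 - t) \<le> (real k - 1) * t"
    by (simp add: algebra_simps)
  also have "\<dots> \<longleftrightarrow> u \<le> (real k - 1) * t / (1 - t)"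
    by (rule pos_le_divide_eq[OF pos(2), symmetric])
  finally show ?thesis .
qed

text \<open>The bid level has no atoms: a level \<open>a\<close> determines \<open>u\<close> as
  \<open>(k - 1) * a / (1 - a)\<close>, and single points are null sets.\<close>

lemma AE_level_bid_neq:
  assumes k: "k \<ge> 2"
  shows "AE u in unif. level_bid k u \<noteq> a"
proof -
  have "AE u in lborel. u \<noteq> (real k - 1) * a / (1 - a)"
    by (rule AE_lborel_singleton)
  then have "AE u in lborel. u \<in> {0<..1} \<longrightarrow> level_bid k u \<noteq> a"
  proof eventually_elim
    case (elim u)
    show ?case
    proof (intro impI notI)
      assume u: "u \<in> {0<..1}" and eq: "level_bid k u = a"
      have "1 / real k < 1" using k by simp
      then have "a < 1" using level_bid_bounds(2)[OF k, of u] u eq by simp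
      moreover have "a * (real k - 1 + u) = u"
        using u k eq by (auto simp: level_bid_def)
      ultimately have "u = (real k - 1) * a / (1 - a)"
        by (simp add: field_simps)
      then show False using elim by simp
    qed
  qed
  then show ?thesis by (intro AE_uniform_measureI) auto
qed

lemma measure_unif_le:
  assumes "0 \<le> s"
  shows "measure unif {u. u \<le> s} = min s 1"
proof -
  have "measure unif {u. u \<le> s} = measure lborel ({0<..1} \<inter> {u. u \<le> s})"
    by (subst measure_uniform_measure) auto
  also have "{0<..1} \<inter> {u. u \<le> s} = {0<..min s 1}" by auto
  finally show ?thesis using assms by simp
qed

text \<open>The cap at 1 becomes active at \<open>t = 1/k\<close>, the upper end of the support,
  where \<open>(k - 1) * t / (1 - t)\<close> reaches 1.\<close>

lemma level_bid_prob:
  assumes k: "k \<ge> 2" and t: "0 \<le> t" "t < 1"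
  shows "measure unif {u. level_bid k u \<le> t} = min ((real k - 1) * t / (1 - t)) 1"
proof -
  have "measure unif {u. level_bid k u \<le> t} = measure unif {u. u \<le> (real k - 1) * t / (1 - t)}"
  proof (rule measure_eq_AE)
    show "AE u in unif. u \<in> {u. level_bid k u \<le> t} \<longleftrightarrow> u \<in> {u. u \<le> (real k - 1) * t / (1 - t)}"
      using AE_unif by eventually_elim (use level_bid_le_iff k t in auto)
  qed (auto intro!: borel_measurable_le)
  also have "\<dots> = min ((real k - 1) * t / (1 - t)) 1"
    using k t by (intro measure_unif_le divide_nonneg_pos mult_nonneg_nonneg) auto
  finally show ?thesis .
qed

text \<open>Consider a bid \<open>t\<close> on one of \<open>k\<close> items, a uniformly random one
  of which carries the random price. If this is the item bid on, winning brings
  \<open>1 - t\<close>; in each of the other \<open>k - 1\<close> positions of the price, the bid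
  costs \<open>t\<close>. For \<open>t \<ge> 1\<close> the left side is nonpositive.\<close>

lemma level_bid_indifference_le:
  assumes k: "k \<ge> 2" and t: "0 \<le> t"
  shows "measure unif {u. level_bid k u \<le> t} * (1 - t) \<le> (real k - 1) * t"
proof (cases "t < 1")
  case True
  have "measure unif {u. level_bid k u \<le> t} \<le> (real k - 1) * t / (1 - t)"
    using level_bid_prob[OF k t True] by simp
  then show ?thesis using True by (simp add: pos_le_divide_eq)
next
  case False
  then have "measure unif {u. level_bid k u \<le> t} * (1 - t) \<le> 0"
    by (intro mult_nonneg_nonpos) auto
  also have "0 \<le> (real k - 1) * t" using k t by simp
  finally show ?thesis .
qed

text \<open>Up to \<open>1/k\<close> the cap in the distribution function is inactive, so all levels
  in the support are equally good.\<close>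

lemma level_bid_indifference_eq:
  assumes k: "k \<ge> 2" and t: "0 \<le> t" "t \<le> 1 / real k"
  shows "measure unif {u. level_bid k u \<le> t} * (1 - t) = (real k - 1) * t"
proof -
  have kt: "real k * t \<le> 1" using k t by (simp add: field_simps)
  have "2 * t \<le> real k * t" using k t by (intro mult_right_mono) auto
  then have t1: "t < 1" using kt t by linarith
  have "(real k - 1) * t / (1 - t) \<le> 1"
    using t1 kt by (simp add: field_simps)
  then show ?thesis using level_bid_prob[OF k t(1) t1] t1 by simp
qed

text \<open>The profit from bids \<open>z\<close> against prices \<open>l\<close> when value 1 is obtained by winning everything.
  Ties count as free wins, which makes this an upper bound under any tie breaking rule.\<close>

definition level_gain :: "nat \<Rightarrow> (nat \<Rightarrow> real) \<Rightarrow> (nat \<Rightarrow> real) \<Rightarrow> real" where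
  "level_gain k z l = of_bool (\<forall>c<k. l c \<le> z c) - (\<Sum>c<k. z c * of_bool (l c < z c))"

lemma abs_level_gain_le:
  assumes "\<And>c. c < k \<Longrightarrow> 0 \<le> z c"
  shows "\<bar>level_gain k z l\<bar> \<le> 1 + (\<Sum>c<k. z c)"
proof -
  have "0 \<le> (\<Sum>c<k. z c * of_bool (l c < z c))" "0 \<le> (\<Sum>c<k. z c)"
    using assms by (auto intro!: sum_nonneg)
  moreover have "(\<Sum>c<k. z c * of_bool (l c < z c)) \<le> (\<Sum>c<k. z c)"
    using assms by (intro sum_mono) auto
  ultimately show ?thesis by (auto simp: level_gain_def of_bool_def)
qed

lemma level_gain_measurable:
  assumes "\<And>c. c < k \<Longrightarrow> (\<lambda>b. z b c) \<in> borel_measurable M"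
    and "\<And>c. c < k \<Longrightarrow> (\<lambda>b. l b c) \<in> borel_measurable M"
  shows "(\<lambda>b. level_gain k (z b) (l b)) \<in> borel_measurable M"
proof -
  have "Measurable.pred M (\<lambda>b. \<forall>c\<in>{..<k}. l b c \<le> z b c)"
    using assms by (intro pred_intros_finite) (auto simp: pred_def intro!: borel_measurable_le)
  moreover have "Measurable.pred M (\<lambda>b. l b c < z b c)" if "c < k" for c
    using assms that by (auto simp: pred_def intro!: borel_measurable_less)
  ultimately show ?thesis unfolding level_gain_def using assms
    by (intro borel_measurable_diff borel_measurable_sum borel_measurable_times
        measurable_compose[OF _ measurable_of_bool]) (auto simp: Ball_def)
qed

text \<open>The items other than \<open>J\<close> have price 0, so they never prevent success and
  \<open>z c\<close> is paid for each of them; where \<open>z c = 0\<close>, paying and not paying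
  agree. At \<open>J\<close>, the weak comparison for the value and the strict one for the payment
  differ only in a tie, a null event, so both become one indicator.\<close>

lemma integral_level_gain_unif:
  assumes k: "k \<ge> 2" and z: "\<And>c. c < k \<Longrightarrow> 0 \<le> z c" and J: "J < k"
  shows "(\<integral>u. level_gain k z (\<lambda>c. if c = J then level_bid k u else 0) \<partial>unif)
    = measure unif {u. level_bid k u \<le> z J} * (1 - z J) - (\<Sum>c<k. z c) + z J"
proof -
  interpret prob_space unif by (rule prob_space_unif)
  have "(\<integral>u. level_gain k z (\<lambda>c. if c = J then level_bid k u else 0) \<partial>unif)
    = (\<integral>u. indicator {u. level_bid k u \<le> z J} u * (1 - z J) - ((\<Sum>c<k. z c) - z J) \<partial>unif)"
  proof (rule integral_cong_AE)
    show "AE u in unif. level_gain k z (\<lambda>c. if c = J then level_bid k u else 0)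
      = indicator {u. level_bid k u \<le> z J} u * (1 - z J) - ((\<Sum>c<k. z c) - z J)"
      using AE_level_bid_neq[OF k, of "z J"]
    proof eventually_elim
      case (elim u)
      have split: "sum f {..<k} = f J + sum f ({..<k} - {J})" for f :: "nat \<Rightarrow> real"
        using J by (simp add: sum.remove)
      have "(\<Sum>c\<in>{..<k} - {J}. z c * of_bool ((if c = J then level_bid k u else 0) < z c))
          = (\<Sum>c\<in>{..<k} - {J}. z c)"
        using z by (intro sum.cong) (auto simp: of_bool_def not_less intro: antisym)
      moreover have "(\<forall>c<k. (if c = J then level_bid k u else 0) \<le> z c) \<longleftrightarrow> level_bid k u \<le> z J"
        using z J by auto
      ultimately show ?case using elim
        by (auto simp: level_gain_def split indicator_def)
    qed
    show "(\<lambda>u. level_gain k z (\<lambda>c. if c = J then level_bid k u else 0)) \<in> borel_measurable unif"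
      unfolding level_gain_def by measurable
    show "(\<lambda>u. indicator {u. level_bid k u \<le> z J} u * (1 - z J) - ((\<Sum>c<k. z c) - z J))
        \<in> borel_measurable unif"
      by measurable
  qed
  also have "\<dots> = measure unif {u. level_bid k u \<le> z J} * (1 - z J) - ((\<Sum>c<k. z c) - z J)"
  proof -
    have "integrable unif (\<lambda>u. indicator {u. level_bid k u \<le> z J} u * (1 - z J))"
      by (rule integrable_const_bound[where B = "\<bar>1 - z J\<bar>"]) (auto simp: indicator_def)
    then show ?thesis by (simp add: prob_space)
  qed
  finally show ?thesis by simp
qed

text \<open>Item \<open>j\<close> belongs to the class \<open>\<kappa> j\<close>, a row or a column of the grid. A uniformly random
  class is bid on at a common random level.\<close>

definition class_strategy :: "nat \<Rightarrow> (nat \<Rightarrow> nat) \<Rightarrow> (nat \<Rightarrow> real) measure" where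
  "class_strategy k \<kappa> = distr (measure_pmf (pmf_of_set {..<k}) \<Otimes>\<^sub>M unif) (bid_space (k * k))
     (\<lambda>(J, u). \<lambda>j\<in>{..<k * k}. if \<kappa> j = J then level_bid k u else 0)"

lemma class_strategy_measurable [measurable]:
  "(\<lambda>(J, u). \<lambda>j\<in>{..<k * k}. if \<kappa> j = J then level_bid k u else 0)
    \<in> measure_pmf (pmf_of_set {..<k}) \<Otimes>\<^sub>M unif \<rightarrow>\<^sub>M bid_space (k * k)"
proof -
  have "(\<lambda>p. if \<kappa> j = fst p then level_bid k (snd p) else 0)
    \<in> borel_measurable (measure_pmf (pmf_of_set {..<k}) \<Otimes>\<^sub>M unif)" for j
    by measurable
  then show ?thesis unfolding case_prod_beta
    by (intro measurable_restrict) auto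
qed

lemma prob_space_class_strategy: "prob_space (class_strategy k \<kappa>)"
  unfolding class_strategy_def
  by (intro prob_space.prob_space_distr prob_space_pair prob_space_unif
      measure_pmf.prob_space_axioms class_strategy_measurable)

lemma sets_class_strategy [simp, measurable_cong]:
  "sets (class_strategy k \<kappa>) = sets (bid_space (k * k))"
  by (simp add: class_strategy_def)

lemma AE_class_strategyI:
  assumes "k \<ge> 2" and P: "Measurable.pred (bid_space (k * k)) P"
    and "\<And>J. J < k \<Longrightarrow>
      AE u in unif. P (\<lambda>j\<in>{..<k * k}. if \<kappa> j = J then level_bid k u else 0)"
  shows "AE \<beta> in class_strategy k \<kappa>. P \<beta>"
proof -
  interpret U: prob_space unif by (rule prob_space_unif)
  interpret pair_sigma_finite "measure_pmf (pmf_of_set {..<k})" unif ..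
  have ne: "{..<k} \<noteq> {}" using assms by (auto simp: lessThan_empty_iff)
  note [measurable] = P
  have "AE J in measure_pmf (pmf_of_set {..<k}). AE u in unif.
     P (\<lambda>j\<in>{..<k * k}. if \<kappa> j = J then level_bid k u else 0)"
    using assms(3) ne by (simp add: AE_measure_pmf_iff)
  then have "AE p in measure_pmf (pmf_of_set {..<k}) \<Otimes>\<^sub>M unif.
     P (case p of (J, u) \<Rightarrow> \<lambda>j\<in>{..<k * k}. if \<kappa> j = J then level_bid k u else 0)"
    by (intro AE_pair_measure) (auto simp: case_prod_beta)
  then show ?thesis unfolding class_strategy_def
    by (subst AE_distr_iff) auto
qed

text \<open>The map \<open>\<rho>\<close> picks one item from each class, so exactly the price at
  position \<open>J\<close> is random. Averaging the formula for fixed \<open>J\<close>, each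
  \<open>z c\<close> is charged separately in the \<open>k - 1\<close> cases
  \<open>J \<noteq> c\<close>, which turns the total into a sum of one-bid terms matching the
  indifference identity.\<close>

lemma integral_level_gain_class_strategy:
  assumes k: "k \<ge> 2" and z: "\<And>c. c < k \<Longrightarrow> 0 \<le> z c"
    and rep: "\<And>c. c < k \<Longrightarrow> \<rho> c < k * k \<and> \<kappa> (\<rho> c) = c"
  shows "(\<integral>\<beta>. level_gain k z (\<lambda>c. \<beta> (\<rho> c)) \<partial>class_strategy k \<kappa>)
    = (\<Sum>J<k. measure unif {u. level_bid k u \<le> z J} * (1 - z J) - (real k - 1) * z J) / real k"
proof -
  let ?h = "\<lambda>J u. level_gain k z (\<lambda>c. if c = J then level_bid k u else 0)"
  interpret U: prob_space unif by (rule prob_space_unif)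
  interpret P: pair_prob_space "measure_pmf (pmf_of_set {..<k})" unif ..
  have ne: "{..<k} \<noteq> {}" using k by (auto simp: lessThan_empty_iff)
  have [measurable]: "(\<lambda>\<beta>. \<beta> (\<rho> c)) \<in> borel_measurable (bid_space (k * k))" if "c < k" for c
    using rep[OF that] by (intro measurable_component_singleton) auto
  have m: "(\<lambda>\<beta>. level_gain k z (\<lambda>c. \<beta> (\<rho> c))) \<in> borel_measurable (bid_space (k * k))"
    unfolding level_gain_def by measurable
  have cong: "level_gain k z (\<lambda>c. (\<lambda>j\<in>{..<k * k}. if \<kappa> j = J then level_bid k u else 0) (\<rho> c))
      = ?h J u" for J u
    using rep by (auto simp: level_gain_def intro!: arg_cong2[where f = "(-)"] sum.cong)
  have "(\<integral>\<beta>. level_gain k z (\<lambda>c. \<beta> (\<rho> c)) \<partial>class_strategy k \<kappa>)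
    = (\<integral>p. ?h (fst p) (snd p) \<partial>(measure_pmf (pmf_of_set {..<k}) \<Otimes>\<^sub>M unif))"
    unfolding class_strategy_def
    by (subst integral_distr[OF class_strategy_measurable m])
      (simp only: case_prod_beta cong)
  also have "\<dots> = (\<integral>J. (\<integral>u. ?h J u \<partial>unif) \<partial>measure_pmf (pmf_of_set {..<k}))"
  proof -
    have "integrable (measure_pmf (pmf_of_set {..<k}) \<Otimes>\<^sub>M unif) (\<lambda>(J, u). ?h J u)"
    proof (rule P.integrable_const_bound[where B = "1 + (\<Sum>c<k. z c)"])
      show "(\<lambda>(J, u). ?h J u) \<in> borel_measurable (measure_pmf (pmf_of_set {..<k}) \<Otimes>\<^sub>M unif)"
        unfolding level_gain_def by measurable
    qed (use abs_level_gain_le[of k z] z in auto)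
    note P.integral_fst'[OF this]
    moreover have "(\<lambda>(J, u). ?h J u) = (\<lambda>p. ?h (fst p) (snd p))"
      by (rule ext) (simp only: case_prod_beta)
    ultimately show ?thesis by (simp only: fst_conv snd_conv)
  qed
  also have "\<dots> = (\<Sum>J<k. \<integral>u. ?h J u \<partial>unif) / real k"
    using ne by (simp add: integral_pmf_of_set)
  also have "(\<Sum>J<k. \<integral>u. ?h J u \<partial>unif)
      = (\<Sum>J<k. measure unif {u. level_bid k u \<le> z J} * (1 - z J) - (\<Sum>c<k. z c) + z J)"
    using integral_level_gain_unif[OF k z] by (intro sum.cong) auto
  also have "\<dots> = (\<Sum>J<k. measure unif {u. level_bid k u \<le> z J} * (1 - z J) - (real k - 1) * z J)"
    by (simp add: sum.distrib sum_subtractf algebra_simps sum_distrib_left)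
  finally show ?thesis .
qed

section \<open>The grid auction\<close>

declare add_2_eq_Suc' [simp del]

section \<open>Values and strategies on the grid\<close>

definition column :: "nat \<Rightarrow> nat \<Rightarrow> nat set" where
  "column k c = (\<lambda>r. c * k + r) ` {..<k}"

text \<open>These are the minimal sets meeting all columns; constant \<open>\<rho>\<close> gives the
  rows.\<close>

definition transversals :: "nat \<Rightarrow> nat set set" where
  "transversals k = {(\<lambda>c. c * k + \<rho> c) ` {..<k} |\<rho>. \<forall>c<k. \<rho> c < k}"

definition grid_val :: "nat \<Rightarrow> nat \<Rightarrow> nat set \<Rightarrow> real" where
  "grid_val k i = contains_member
     (if i = 0 then transversals k else if i = 1 then column k ` {..<k} else {column k (i - 2)})"

lemma grid_val_SAW_class: "grid_val (Suc d) i \<in> SAW_class m d"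
  unfolding grid_val_def
proof (rule contains_member_SAW_class)
  show "{} \<notin> (if i = 0 then transversals (Suc d) else if i = 1 then column (Suc d) ` {..<Suc d}
      else {column (Suc d) (i - 2)})"
    by (auto simp: transversals_def column_def lessThan_empty_iff)
qed (auto simp: transversals_def column_def split: if_splits
    intro!: card_image_le[THEN order_trans])

lemma grid_val_bounds: "0 \<le> grid_val k i S" "grid_val k i S \<le> 1"
  by (auto simp: grid_val_def contains_member_def)

lemma grid_val_0: "grid_val k 0 S = of_bool (\<forall>c<k. \<exists>r<k. c * k + r \<in> S)"
proof -
  have "(\<exists>A\<in>transversals k. A \<subseteq> S) \<longleftrightarrow> (\<exists>\<rho>. \<forall>c<k. \<rho> c < k \<and> c * k + \<rho> c \<in> S)"
    unfolding transversals_def by blast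
  also have "\<dots> \<longleftrightarrow> (\<forall>c<k. \<exists>r<k. c * k + r \<in> S)"
    by (rule choice_iff'[symmetric])
  finally show ?thesis by (simp add: grid_val_def contains_member_def)
qed

lemma grid_val_1: "grid_val k 1 S = of_bool (\<exists>c<k. \<forall>r<k. c * k + r \<in> S)"
  by (auto simp: grid_val_def contains_member_def column_def intro!: arg_cong[where f = of_bool])

lemma grid_val_column: "grid_val k (c + 2) S = of_bool (\<forall>r<k. c * k + r \<in> S)"
  by (auto simp: grid_val_def contains_member_def column_def intro!: arg_cong[where f = of_bool])

lemma grid_item_less: "c < k \<Longrightarrow> r < k \<Longrightarrow> c * k + r < k * (k::nat)"
proof -
  assume "c < k" "r < k"
  then have "c * k + r < c * k + k" by simp
  also have "\<dots> = Suc c * k" by simp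
  also have "\<dots> \<le> k * k" using \<open>c < k\<close> by (intro mult_le_mono1) simp
  finally show ?thesis .
qed

lemma sum_grid: "(\<Sum>j<k * k. f j) = (\<Sum>c<k. \<Sum>r<k. f (c * k + r))" for k :: nat
proof -
  have "(\<Sum>j<k * k. f j) = (\<Sum>c<k. sum f {c * k..<c * k + k})"
    by (rule sum.nat_group[symmetric])
  also have "\<dots> = (\<Sum>c<k. \<Sum>r<k. f (c * k + r))"
    by (rule sum.cong[OF refl]) (simp add: sum.atLeastLessThan_shift_0 atLeast0LessThan)
  finally show ?thesis .
qed

definition grid_strategy :: "nat \<Rightarrow> nat \<Rightarrow> (nat \<Rightarrow> real) measure" where
  "grid_strategy k i = (if i = 0 then class_strategy k (\<lambda>j. j mod k)
     else if i = 1 then class_strategy k (\<lambda>j. j div k)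
     else return (bid_space (k * k)) (\<lambda>j\<in>{..<k * k}. 0))"

lemma grid_strategy_0: "grid_strategy k 0 = class_strategy k (\<lambda>j. j mod k)"
  and grid_strategy_1: "grid_strategy k 1 = class_strategy k (\<lambda>j. j div k)"
  and grid_strategy_idle:
    "i \<ge> 2 \<Longrightarrow> grid_strategy k i = return (bid_space (k * k)) (\<lambda>j\<in>{..<k * k}. 0)"
  by (auto simp: grid_strategy_def)

text \<open>The almost sure shape of a bid drawn from \<open>class_strategy\<close>. Positivity of
  \<open>t\<close> is what keeps the idle bidders from winning items of the chosen class.\<close>

definition class_bid :: "nat \<Rightarrow> (nat \<Rightarrow> nat) \<Rightarrow> (nat \<Rightarrow> real) \<Rightarrow> bool" where
  "class_bid k \<kappa> \<beta> \<longleftrightarrow> (\<exists>J<k. \<exists>t. 0 < t \<and> t \<le> 1 / real k \<and>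
     (\<forall>j<k * k. \<beta> j = (if \<kappa> j = J then t else 0)))"

lemma AE_class_bid:
  assumes k: "k \<ge> 2" and rep: "\<And>c. c < k \<Longrightarrow> \<rho> c < k * k \<and> \<kappa> (\<rho> c) = c"
  shows "AE \<beta> in class_strategy k \<kappa>. class_bid k \<kappa> \<beta>"
proof -
  have [measurable]: "(\<lambda>\<beta>. \<beta> j) \<in> borel_measurable (bid_space (k * k))" if "j < k * k" for j
    using that by (intro measurable_component_singleton) auto
  \<comment> \<open>The level is read off at the representative item \<open>\<rho> J\<close>. This
    replaces the quantifier over real \<open>t\<close> by finite quantifiers, which makes the
    predicate measurable.\<close>
  let ?P = "\<lambda>\<beta>. \<exists>J\<in>{..<k}. 0 < \<beta> (\<rho> J) \<and> \<beta> (\<rho> J) \<le> 1 / real k \<and>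
     (\<forall>j\<in>{..<k * k}. \<beta> j = (if \<kappa> j = J then \<beta> (\<rho> J) else 0))"
  have "AE \<beta> in class_strategy k \<kappa>. ?P \<beta>"
  proof (rule AE_class_strategyI[OF k])
    show "Measurable.pred (bid_space (k * k)) ?P"
    proof (intro pred_intros_finite pred_intros_logic finite_lessThan)
      fix J j assume "J \<in> {..<k}" "j \<in> {..<k * k}"
      then have [measurable]: "(\<lambda>\<beta>. \<beta> (\<rho> J)) \<in> borel_measurable (bid_space (k * k))"
        "(\<lambda>\<beta>. \<beta> j) \<in> borel_measurable (bid_space (k * k))"
        using rep by auto
      show "Measurable.pred (bid_space (k * k)) (\<lambda>\<beta>. \<beta> j = (if \<kappa> j = J then \<beta> (\<rho> J) else 0))"
      proof (cases "\<kappa> j = J")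
        case True
        have "Measurable.pred (bid_space (k * k)) (\<lambda>\<beta>. \<beta> j = \<beta> (\<rho> J))"
          using \<open>J \<in> {..<k}\<close> \<open>j \<in> {..<k * k}\<close> rep unfolding pred_def
          by (intro borel_measurable_eq) auto
        then show ?thesis using True by simp
      next
        case False
        then show ?thesis by simp
      qed
    next
      fix J assume "J \<in> {..<k}"
      then have [measurable]: "(\<lambda>\<beta>. \<beta> (\<rho> J)) \<in> borel_measurable (bid_space (k * k))"
        using rep by auto
      show "Measurable.pred (bid_space (k * k)) (\<lambda>\<beta>. 0 < \<beta> (\<rho> J))"
        "Measurable.pred (bid_space (k * k)) (\<lambda>\<beta>. \<beta> (\<rho> J) \<le> 1 / real k)"
        by measurable
    qed
    fix J assume J: "J < k"
    show "AE u in unif. ?P (\<lambda>j\<in>{..<k * k}. if \<kappa> j = J then level_bid k u else 0)"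
      using AE_unif
    proof eventually_elim
      case (elim u)
      then show ?case using level_bid_bounds[OF k, of u] rep[OF J] J
        by (intro bexI[of _ J]) auto
    qed
  qed
  then show ?thesis
  proof eventually_elim
    case (elim \<beta>)
    then obtain J where "J < k" "0 < \<beta> (\<rho> J)" "\<beta> (\<rho> J) \<le> 1 / real k"
      "\<forall>j<k * k. \<beta> j = (if \<kappa> j = J then \<beta> (\<rho> J) else 0)" by blast
    then show ?case unfolding class_bid_def by blast
  qed
qed

text \<open>Only the value 0 can be an atom of the bid on a single item: it is the bid outside the
  chosen class, while the level inside is atomless.\<close>

lemma AE_class_strategy_neq:
  assumes k: "k \<ge> 2" and j: "j < k * k"
  shows "AE \<beta> in class_strategy k \<kappa>. \<beta> j = a \<longrightarrow> a = 0"
proof (rule AE_class_strategyI[OF k])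
  have [measurable]: "(\<lambda>\<beta>. \<beta> j) \<in> borel_measurable (bid_space (k * k))"
    using j by (intro measurable_component_singleton) auto
  show "Measurable.pred (bid_space (k * k)) (\<lambda>\<beta>. \<beta> j = a \<longrightarrow> a = 0)"
    by measurable
  fix J
  show "AE u in unif. (\<lambda>j\<in>{..<k * k}. if \<kappa> j = J then level_bid k u else 0) j = a \<longrightarrow> a = 0"
    using AE_level_bid_neq[OF k, of a] by eventually_elim (use j in auto)
qed

abbreviation play :: "nat \<Rightarrow> (nat \<Rightarrow> nat \<Rightarrow> real) measure" where
  "play k \<equiv> Pi\<^sub>M {..<k + 2} (grid_strategy k)"

definition typical :: "nat \<Rightarrow> (nat \<Rightarrow> nat \<Rightarrow> real) \<Rightarrow> bool" where
  "typical k b \<longleftrightarrow> b \<in> space (profile_space (k + 2) (k * k)) \<and>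
     class_bid k (\<lambda>j. j mod k) (b 0) \<and> class_bid k (\<lambda>j. j div k) (b 1) \<and>
     (\<forall>i<k + 2. 2 \<le> i \<longrightarrow> (\<forall>j<k * k. b i j = 0))"

section \<open>Almost sure behavior of the profile and expected gains against it\<close>

context
  fixes k :: nat
  assumes k: "k \<ge> 2"
begin

text \<open>Rows are represented by their items in column 0; likewise, columns will be represented
  by their items in row 0.\<close>

lemma row_rep: "c < k \<Longrightarrow> c < k * k \<and> c mod k = c"
  using grid_item_less[of 0 k c] by auto

lemma column_rep: "c < k \<Longrightarrow> c * k < k * k \<and> c * k div k = c"
  by auto

lemma prob_space_grid_strategy: "prob_space (grid_strategy k i)"
  by (auto simp: grid_strategy_def space_PiM intro!: prob_space_class_strategy prob_space_return)

lemma sets_grid_strategy: "sets (grid_strategy k i) = sets (bid_space (k * k))"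
  by (simp add: grid_strategy_def)

lemma AE_grid_strategy_idle:
  assumes "i \<ge> 2"
  shows "AE \<beta> in grid_strategy k i. \<forall>j\<in>{..<k * k}. \<beta> j = 0"
proof -
  have "Measurable.pred (bid_space (k * k)) (\<lambda>\<beta>. \<forall>j\<in>{..<k * k}. \<beta> j = 0)"
  proof (intro pred_intros_finite finite_lessThan)
    fix j assume "j \<in> {..<k * k}"
    then have [measurable]: "(\<lambda>\<beta>. \<beta> j) \<in> borel_measurable (bid_space (k * k))"
      by (rule measurable_component_singleton)
    show "Measurable.pred (bid_space (k * k)) (\<lambda>\<beta>. \<beta> j = 0)" by measurable
  qed
  then have "AE \<beta> in return (bid_space (k * k)) (\<lambda>j\<in>{..<k * k}. 0). \<forall>j\<in>{..<k * k}. \<beta> j = 0"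
    by (subst AE_return) (auto simp: space_PiM)
  then show ?thesis unfolding grid_strategy_idle[OF assms] .
qed

lemma prob_space_play: "prob_space (play k)"
  by (intro prob_space_PiM prob_space_grid_strategy)

lemma sets_play [measurable_cong]: "sets (play k) = sets (profile_space (k + 2) (k * k))"
  by (intro sets_PiM_cong refl sets_grid_strategy)

lemma space_play: "space (play k) = space (profile_space (k + 2) (k * k))"
  by (rule sets_eq_imp_space_eq[OF sets_play])

lemma bid_measurable [measurable]:
  assumes "i < k + 2" "j < k * k"
  shows "(\<lambda>b. b i j) \<in> borel_measurable (play k)"
proof -
  have "(\<lambda>b. b i) \<in> profile_space (k + 2) (k * k) \<rightarrow>\<^sub>M bid_space (k * k)"
    using assms by (intro measurable_component_singleton) auto
  moreover have "(\<lambda>x. x j) \<in> bid_space (k * k) \<rightarrow>\<^sub>M borel"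
    using assms by (intro measurable_component_singleton) auto
  ultimately have "(\<lambda>b. b i j) \<in> borel_measurable (profile_space (k + 2) (k * k))"
    by (rule measurable_compose)
  then show ?thesis using measurable_cong_sets[OF sets_play refl] by blast
qed

lemma AE_play_component:
  assumes "i < k + 2" "AE \<beta> in grid_strategy k i. P \<beta>"
  shows "AE b in play k. P (b i)"
  using assms by (intro AE_PiM_component prob_space_grid_strategy) auto

lemma AE_class_bid_row: "AE \<beta> in grid_strategy k 0. class_bid k (\<lambda>j. j mod k) \<beta>"
  unfolding grid_strategy_0 using row_rep by (rule AE_class_bid[OF k])

lemma AE_class_bid_column: "AE \<beta> in grid_strategy k 1. class_bid k (\<lambda>j. j div k) \<beta>"
  unfolding grid_strategy_1 using column_rep by (rule AE_class_bid[OF k])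

lemma AE_typical: "AE b in play k. typical k b"
proof -
  have "AE b in play k. \<forall>i\<in>{2..<k + 2}. \<forall>j\<in>{..<k * k}. b i j = 0"
    by (intro AE_ball_countable' AE_play_component AE_grid_strategy_idle) auto
  moreover have "AE b in play k. class_bid k (\<lambda>j. j mod k) (b 0)"
    using AE_class_bid_row by (intro AE_play_component) auto
  moreover have "AE b in play k. class_bid k (\<lambda>j. j div k) (b 1)"
    using AE_class_bid_column by (intro AE_play_component) auto
  moreover have "AE b in play k. b \<in> space (profile_space (k + 2) (k * k))"
    unfolding space_play[symmetric] by (rule AE_space)
  ultimately show ?thesis
    by eventually_elim (auto simp: typical_def)
qed

lemma typical_row:
  assumes "typical k b"
  obtains J t where "J < k" "0 < t" "t \<le> 1 / real k"
    "\<And>c r. c < k \<Longrightarrow> r < k \<Longrightarrow> b 0 (c * k + r) = (if r = J then t else 0)"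
    "\<And>r. r < k \<Longrightarrow> b 0 r = (if r = J then t else 0)"
proof -
  from assms obtain J t where J: "J < k" "0 < t" "t \<le> 1 / real k"
    and b: "\<And>j. j < k * k \<Longrightarrow> b 0 j = (if j mod k = J then t else 0)"
    by (auto simp: typical_def class_bid_def)
  show ?thesis
  proof (rule that[OF J])
    fix c r assume "c < k" "r < k"
    then show "b 0 (c * k + r) = (if r = J then t else 0)"
      using b[OF grid_item_less[of c k r]] by simp
  next
    fix r assume "r < k"
    then show "b 0 r = (if r = J then t else 0)"
      using b[of r] row_rep[of r] by simp
  qed
qed

lemma typical_column:
  assumes "typical k b"
  obtains J t where "J < k" "0 < t" "t \<le> 1 / real k"
    "\<And>c r. c < k \<Longrightarrow> r < k \<Longrightarrow> b 1 (c * k + r) = (if c = J then t else 0)"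
    "\<And>c. c < k \<Longrightarrow> b 1 (c * k) = (if c = J then t else 0)"
proof -
  from assms obtain J t where J: "J < k" "0 < t" "t \<le> 1 / real k"
    and b: "\<And>j. j < k * k \<Longrightarrow> b 1 j = (if j div k = J then t else 0)"
    by (auto simp: typical_def class_bid_def)
  show ?thesis
  proof (rule that[OF J])
    fix c r assume "c < k" "r < k"
    then show "b 1 (c * k + r) = (if c = J then t else 0)"
      using b[OF grid_item_less[of c k r]] by simp
  next
    fix c assume "c < k"
    then show "b 1 (c * k) = (if c = J then t else 0)"
      using b[of "c * k"] column_rep[of c] k by simp
  qed
qed

text \<open>For each fixed bid of bidder 1, bidder 0 matches a nonzero entry with probability 0, and
  integrating over bidder 1 preserves this. Common bids of 0 do occur, but they cost
  nothing.\<close>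

lemma AE_no_tie:
  "AE b in play k. \<forall>j\<in>{..<k * k}. b 0 j = b 1 j \<longrightarrow> b 1 j = 0"
proof (rule AE_ball_countable')
  fix j assume "j \<in> {..<k * k}"
  then have j: "j < k * k" by simp
  interpret prob_space "play k" by (rule prob_space_play)
  \<comment> \<open>\<open>G\<close> is the indicator of a nonzero tie on item \<open>j\<close>.
    Being nonnegative, it vanishes almost everywhere once its integral is at most 0.\<close>
  define G :: "(nat \<Rightarrow> real) \<Rightarrow> (nat \<Rightarrow> real) \<Rightarrow> real"
    where "G y x = of_bool (y j = x j \<and> x j \<noteq> 0)" for y x
  have int: "integrable (play k) (\<lambda>b. G (b 0) (b 1))"
  proof (rule integrable_const_bound[where B = 1])
    show "(\<lambda>b. G (b 0) (b 1)) \<in> borel_measurable (play k)"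
    proof -
      have "Measurable.pred (play k) (\<lambda>b. b 0 j = b 1 j)" "Measurable.pred (play k) (\<lambda>b. b 1 j = 0)"
        unfolding pred_def by (intro borel_measurable_eq bid_measurable borel_measurable_const;
            use j in simp)+
      then have "Measurable.pred (play k) (\<lambda>b. b 0 j = b 1 j \<and> b 1 j \<noteq> 0)"
        by (intro pred_intros_logic)
      then show ?thesis unfolding G_def by (rule measurable_compose[OF _ measurable_of_bool])
    qed
  qed (auto simp: G_def)
  have "(\<integral>y. G y x \<partial>grid_strategy k 0) = 0" for x
  proof (rule integral_eq_zero_AE)
    show "AE y in grid_strategy k 0. G y x = 0"
      using AE_class_strategy_neq[OF k j, where \<kappa> = "\<lambda>j. j mod k" and a = "x j",
          folded grid_strategy_0]
      by eventually_elim (auto simp: G_def)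
  qed
  then have "(\<integral>b. G (b 0) (b 1) \<partial>play k) \<le> 0"
    using int by (intro integral_PiM_pair_nonpos prob_space_grid_strategy) auto
  moreover have "0 \<le> (\<integral>b. G (b 0) (b 1) \<partial>play k)"
    by (rule integral_nonneg_AE) (auto simp: G_def)
  ultimately have "(\<integral>b. G (b 0) (b 1) \<partial>play k) = 0" by simp
  then have "AE b in play k. G (b 0) (b 1) = 0"
    using int by (subst (asm) integral_nonneg_eq_0_iff_AE) (auto simp: G_def)
  then show "AE b in play k. b 0 j = b 1 j \<longrightarrow> b 1 j = 0"
    by eventually_elim (auto simp: G_def)
qed auto

text \<open>This is the purchase of one column against bidder 0, with bid \<open>z r\<close> in row
  \<open>r\<close>. The price in row \<open>r\<close> is the same in every column, so
  \<open>\<beta> r\<close> stands for it, and each summand is nonpositive by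
  \<open>level_bid_indifference_le\<close>.\<close>

lemma level_gain_row_nonpos:
  assumes "\<And>r. r < k \<Longrightarrow> 0 \<le> z r"
  shows "(\<integral>\<beta>. level_gain k z (\<lambda>r. \<beta> r) \<partial>grid_strategy k 0) \<le> 0"
proof -
  have "(\<integral>\<beta>. level_gain k z (\<lambda>r. \<beta> r) \<partial>grid_strategy k 0)
    = (\<Sum>J<k. measure unif {u. level_bid k u \<le> z J} * (1 - z J) - (real k - 1) * z J) / real k"
    unfolding grid_strategy_0 using integral_level_gain_class_strategy[OF k assms row_rep] by simp
  also have "\<dots> \<le> 0"
    using level_bid_indifference_le[OF k] assms
    by (intro divide_nonpos_nonneg sum_nonpos) auto
  finally show ?thesis .
qed

lemma level_gain_column_nonpos:
  assumes "\<And>c. c < k \<Longrightarrow> 0 \<le> z c"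
  shows "(\<integral>\<beta>. level_gain k z (\<lambda>c. \<beta> (c * k)) \<partial>grid_strategy k 1) \<le> 0"
proof -
  have "(\<integral>\<beta>. level_gain k z (\<lambda>c. \<beta> (c * k)) \<partial>grid_strategy k 1)
    = (\<Sum>J<k. measure unif {u. level_bid k u \<le> z J} * (1 - z J) - (real k - 1) * z J) / real k"
    unfolding grid_strategy_1
    using integral_level_gain_class_strategy[OF k assms column_rep] by simp
  also have "\<dots> \<le> 0"
    using level_bid_indifference_le[OF k] assms
    by (intro divide_nonpos_nonneg sum_nonpos) auto
  finally show ?thesis .
qed

text \<open>This is the indifference that supports mixing: a common bid at any level of the support
  on all items of one line earns exactly 0 against the crossing lines.\<close>

lemma level_gain_zero:
  assumes t: "0 \<le> t" "t \<le> 1 / real k"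
  shows "(\<integral>\<beta>. level_gain k (\<lambda>_. t) (\<lambda>r. \<beta> r) \<partial>grid_strategy k 0) = 0"
    and "(\<integral>\<beta>. level_gain k (\<lambda>_. t) (\<lambda>c. \<beta> (c * k)) \<partial>grid_strategy k 1) = 0"
  unfolding grid_strategy_0 grid_strategy_1
  using integral_level_gain_class_strategy[OF k _ row_rep, of "\<lambda>_. t"]
    integral_level_gain_class_strategy[OF k _ column_rep, of "\<lambda>_. t"]
    level_bid_indifference_eq[OF k t] t by simp_all

end

section \<open>The equilibrium\<close>

context
  fixes k :: nat and w :: "(nat \<Rightarrow> nat \<Rightarrow> real) \<Rightarrow> nat \<Rightarrow> nat"
  assumes k: "k \<ge> 2" and rule: "highest_bid_rule (k + 2) (k * k) w"
begin

abbreviation won :: "(nat \<Rightarrow> nat \<Rightarrow> real) \<Rightarrow> nat \<Rightarrow> nat set" where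
  "won b i \<equiv> bundle_of (k * k) (w b) i"

abbreviation pay :: "nat \<Rightarrow> (nat \<Rightarrow> nat \<Rightarrow> real) \<Rightarrow> real" where
  "pay \<equiv> utility (k * k) (grid_val k) w"

text \<open>Winning yields weak comparisons, and \<open>wonI\<close> asks for strict ones. Between
  them these two facts cover every way of breaking ties.\<close>

lemma won_highest:
  assumes "b \<in> space (profile_space (k + 2) (k * k))" "j \<in> won b i" "i' < k + 2"
  shows "b i' j \<le> b i j"
  using assms rule by (auto simp: bundle_of_def highest_bid_rule_def)

lemma wonI:
  assumes "b \<in> space (profile_space (k + 2) (k * k))" "j < k * k" "i < k + 2"
    and "\<And>i'. i' < k + 2 \<Longrightarrow> i' \<noteq> i \<Longrightarrow> b i' j < b i j"
  shows "j \<in> won b i"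
proof -
  have "w b j < k + 2" "b i j \<le> b (w b j) j"
    using assms(1,2,3) rule by (auto simp: highest_bid_rule_def)
  then have "w b j = i" using assms(4)[of "w b j"] by force
  then show ?thesis using assms(2) by (simp add: bundle_of_def)
qed

lemma pay_grid:
  "pay i b = grid_val k i (won b i) - (\<Sum>c<k. \<Sum>r<k. b i (c * k + r) * of_bool (c * k + r \<in> won b i))"
proof -
  have "(\<Sum>j\<in>won b i. b i j) = (\<Sum>j<k * k. b i j * of_bool (j \<in> won b i))"
    by (rule sum.mono_neutral_cong_left) (auto simp: bundle_of_def)
  then show ?thesis by (simp add: utility_def sum_grid)
qed

lemma space_deviation:
  assumes "b \<in> space (profile_space (k + 2) (k * k))" "z \<in> space (bid_space (k * k))" "i < k + 2"
  shows "b(i := z) \<in> space (profile_space (k + 2) (k * k))"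
  using assms by (auto simp: space_PiM PiE_def Pi_def extensional_def)

section \<open>Pointwise upper bounds on deviation profits\<close>

text \<open>Bidder 1's bid is constant on each column, so in column \<open>c\<close> only the
  largest bid of \<open>z\<close> matters. Winning any item there requires this maximum to reach the
  price, and if the maximum exceeds the price, the item attaining it is won and paid for.\<close>

lemma deviation_0_bound:
  assumes b: "typical k b" and z: "z \<in> space (bid_space (k * k))" "\<And>j. j < k * k \<Longrightarrow> 0 \<le> z j"
  shows "pay 0 (b(0 := z))
    \<le> level_gain k (\<lambda>c. Max ((\<lambda>r. z (c * k + r)) ` {..<k})) (\<lambda>c. b 1 (c * k))"
proof -
  let ?b = "b(0 := z)" and ?Z = "\<lambda>c. Max ((\<lambda>r. z (c * k + r)) ` {..<k})"
  have bs: "?b \<in> space (profile_space (k + 2) (k * k))"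
    using b z(1) by (intro space_deviation) (auto simp: typical_def)
  obtain C t where C: "C < k" "0 < t" "t \<le> 1 / real k"
    "\<And>c r. c < k \<Longrightarrow> r < k \<Longrightarrow> b 1 (c * k + r) = (if c = C then t else 0)"
    "\<And>c. c < k \<Longrightarrow> b 1 (c * k) = (if c = C then t else 0)"
    using typical_column[OF k b] by blast
  have Z: "z (c * k + r) \<le> ?Z c" if "r < k" for c r
    using that by (intro Max_ge) auto
  have "of_bool (\<forall>c<k. \<exists>r<k. c * k + r \<in> won ?b 0) \<le> (of_bool (\<forall>c<k. b 1 (c * k) \<le> ?Z c) :: real)"
  proof -
    have "b 1 (c * k) \<le> ?Z c" if c: "c < k" and r: "r < k" "c * k + r \<in> won ?b 0" for c r
    proof -
      have "b 1 (c * k) = b 1 (c * k + r)" using C c r by simp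
      also have "\<dots> \<le> z (c * k + r)" using won_highest[OF bs r(2), of 1] by simp
      also have "\<dots> \<le> ?Z c" using Z r by simp
      finally show ?thesis .
    qed
    then show ?thesis by auto
  qed
  moreover have "?Z c * of_bool (b 1 (c * k) < ?Z c)
      \<le> (\<Sum>r<k. ?b 0 (c * k + r) * of_bool (c * k + r \<in> won ?b 0))" if c: "c < k" for c
  proof (cases "b 1 (c * k) < ?Z c")
    case True
    have "?Z c \<in> (\<lambda>r. z (c * k + r)) ` {..<k}"
      using c by (intro Max_in) auto
    then obtain r where r: "r < k" "?Z c = z (c * k + r)" by auto
    have j: "c * k + r < k * k" using grid_item_less c r by simp
    have "c * k + r \<in> won ?b 0"
    proof (rule wonI[OF bs j])
      fix i assume i: "i < k + 2" "i \<noteq> 0"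
      have pos: "0 < z (c * k + r)" "b 1 (c * k + r) < z (c * k + r)"
        using True r C c by (auto split: if_splits)
      show "?b i (c * k + r) < ?b 0 (c * k + r)"
      proof (cases "i = 1")
        case False
        then have "b i (c * k + r) = 0" using i j b by (auto simp: typical_def)
        then show ?thesis using pos i by simp
      qed (use pos in simp)
    qed simp
    then have "?Z c = ?b 0 (c * k + r) * of_bool (c * k + r \<in> won ?b 0)" using r by simp
    also have "\<dots> \<le> (\<Sum>r<k. ?b 0 (c * k + r) * of_bool (c * k + r \<in> won ?b 0))"
      using r z(2) grid_item_less c
      by (intro member_le_sum[where f = "\<lambda>r. ?b 0 (c * k + r) * of_bool (c * k + r \<in> won ?b 0)"]) auto
    finally show ?thesis using True by simp
  next
    case False
    then show ?thesis using z(2) grid_item_less c by (auto intro!: sum_nonneg)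
  qed
  then have "(\<Sum>c<k. ?Z c * of_bool (b 1 (c * k) < ?Z c))
      \<le> (\<Sum>c<k. \<Sum>r<k. ?b 0 (c * k + r) * of_bool (c * k + r \<in> won ?b 0))"
    by (intro sum_mono) simp
  ultimately show ?thesis
    unfolding pay_grid grid_val_0 level_gain_def by linarith
qed

text \<open>Treat each column as a separate purchase: payments split over the columns, and the value
  of obtaining at least one column is at most the number of columns obtained. Bidder 0's prices
  depend only on the row.\<close>

lemma deviation_1_bound:
  assumes b: "typical k b" and z: "z \<in> space (bid_space (k * k))" "\<And>j. j < k * k \<Longrightarrow> 0 \<le> z j"
  shows "pay 1 (b(1 := z)) \<le> (\<Sum>c<k. level_gain k (\<lambda>r. z (c * k + r)) (\<lambda>r. b 0 r))"
proof -
  let ?b = "b(1 := z)"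
  have bs: "?b \<in> space (profile_space (k + 2) (k * k))"
    using b z(1) by (intro space_deviation) (auto simp: typical_def)
  obtain J t where J: "J < k" "0 < t" "t \<le> 1 / real k"
    "\<And>c r. c < k \<Longrightarrow> r < k \<Longrightarrow> b 0 (c * k + r) = (if r = J then t else 0)"
    "\<And>r. r < k \<Longrightarrow> b 0 r = (if r = J then t else 0)"
    using typical_row[OF k b] by blast
  have "of_bool (\<exists>c<k. \<forall>r<k. c * k + r \<in> won ?b 1)
      \<le> (\<Sum>c<k. of_bool (\<forall>r<k. b 0 r \<le> z (c * k + r)) :: real)"
  proof (cases "\<exists>c<k. \<forall>r<k. c * k + r \<in> won ?b 1")
    case True
    then obtain c where c: "c < k" "\<And>r. r < k \<Longrightarrow> c * k + r \<in> won ?b 1" by blast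
    have "b 0 r \<le> z (c * k + r)" if r: "r < k" for r
      using won_highest[OF bs c(2)[OF r], of 0] J c r by simp
    then have "1 = (of_bool (\<forall>r<k. b 0 r \<le> z (c * k + r)) :: real)" by simp
    also have "\<dots> \<le> (\<Sum>c<k. of_bool (\<forall>r<k. b 0 r \<le> z (c * k + r)))"
      using c by (intro member_le_sum[where f = "\<lambda>c. of_bool (\<forall>r<k. b 0 r \<le> z (c * k + r))"]) auto
    finally show ?thesis by (simp add: True)
  next
    case False
    then show ?thesis by (simp only: of_bool_def if_False) (simp add: sum_nonneg)
  qed
  moreover have "(\<Sum>c<k. \<Sum>r<k. z (c * k + r) * of_bool (b 0 r < z (c * k + r)))
      \<le> (\<Sum>c<k. \<Sum>r<k. ?b 1 (c * k + r) * of_bool (c * k + r \<in> won ?b 1))"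
  proof (intro sum_mono)
    fix c r assume "c \<in> {..<k}" "r \<in> {..<k}"
    then have c: "c < k" and r: "r < k" by auto
    have j: "c * k + r < k * k" using grid_item_less c r by simp
    have "c * k + r \<in> won ?b 1" if less: "b 0 r < z (c * k + r)"
    proof (rule wonI[OF bs j])
      fix i assume i: "i < k + 2" "i \<noteq> 1"
      have pos: "0 < z (c * k + r)" "b 0 (c * k + r) < z (c * k + r)"
        using less J c r by (auto split: if_splits)
      show "?b i (c * k + r) < ?b 1 (c * k + r)"
      proof (cases "i = 0")
        case False
        then have "b i (c * k + r) = 0" using i j b by (auto simp: typical_def)
        then show ?thesis using pos i by simp
      qed (use pos in simp)
    qed simp
    then show "z (c * k + r) * of_bool (b 0 r < z (c * k + r))
        \<le> ?b 1 (c * k + r) * of_bool (c * k + r \<in> won ?b 1)"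
      using z(2)[OF j] by auto
  qed
  ultimately show ?thesis
    unfolding pay_grid grid_val_1 level_gain_def sum_subtractf by linarith
qed

text \<open>The indicator says that \<open>z\<close> reaches bidder 1's bids throughout column
  \<open>c\<close>. Where it is 0, the column cannot be won and payments are nonnegative; where it
  is 1, only bidder 0's prices remain. It depends on bidder 1 alone, so it acts as a constant when
  bidder 0's bids are integrated.\<close>

lemma deviation_column_bound:
  assumes b: "typical k b" and z: "z \<in> space (bid_space (k * k))" "\<And>j. j < k * k \<Longrightarrow> 0 \<le> z j"
    and c: "c < k" and no_tie: "\<And>j. j < k * k \<Longrightarrow> b 1 j = z j \<Longrightarrow> z j = 0"
  shows "pay (c + 2) (b(c + 2 := z)) \<le> of_bool (\<forall>r<k. b 1 (c * k + r) \<le> z (c * k + r))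
    * level_gain k (\<lambda>r. z (c * k + r)) (\<lambda>r. b 0 r)"
proof -
  let ?b = "b(c + 2 := z)"
  have bs: "?b \<in> space (profile_space (k + 2) (k * k))"
    using b z(1) c by (intro space_deviation) (auto simp: typical_def)
  obtain J t where J: "J < k" "0 < t" "t \<le> 1 / real k"
    "\<And>c r. c < k \<Longrightarrow> r < k \<Longrightarrow> b 0 (c * k + r) = (if r = J then t else 0)"
    "\<And>r. r < k \<Longrightarrow> b 0 r = (if r = J then t else 0)"
    using typical_row[OF k b] by blast
  let ?p = "\<lambda>c' r. ?b (c + 2) (c' * k + r) * of_bool (c' * k + r \<in> won ?b (c + 2))"
  have p: "0 \<le> ?p c' r" if "c' < k" "r < k" for c' r
    using z(2) grid_item_less that by simp
  have high: "b 0 r \<le> z (c * k + r)" "b 1 (c * k + r) \<le> z (c * k + r)"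
    if r: "r < k" "c * k + r \<in> won ?b (c + 2)" for r
    using won_highest[OF bs r(2), of 0] won_highest[OF bs r(2), of 1] J c r by auto
  show ?thesis
  proof (cases "\<forall>r<k. b 1 (c * k + r) \<le> z (c * k + r)")
    case True
    have "of_bool (\<forall>r<k. c * k + r \<in> won ?b (c + 2)) \<le> (of_bool (\<forall>r<k. b 0 r \<le> z (c * k + r)) :: real)"
      using high by auto
    moreover have "(\<Sum>r<k. z (c * k + r) * of_bool (b 0 r < z (c * k + r))) \<le> (\<Sum>r<k. ?p c r)"
    proof (rule sum_mono)
      fix r assume "r \<in> {..<k}"
      then have r: "r < k" by simp
      have j: "c * k + r < k * k" using grid_item_less c r by simp
      have "c * k + r \<in> won ?b (c + 2)" if less: "b 0 r < z (c * k + r)"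
      proof (rule wonI[OF bs j])
        fix i assume i: "i < k + 2" "i \<noteq> c + 2"
        have pos: "0 < z (c * k + r)" "b 0 (c * k + r) < z (c * k + r)"
          using less J c r by (auto split: if_splits)
        \<comment> \<open>The bid is positive here, so \<open>no_tie\<close> excludes equality with
          bidder 1.\<close>
        have b1: "b 1 (c * k + r) < z (c * k + r)"
          using True r no_tie[OF j] pos by force
        consider "i = 0" | "i = 1" | "i \<ge> 2" by linarith
        then show "?b i (c * k + r) < ?b (c + 2) (c * k + r)"
        proof cases
          case 3
          then have "b i (c * k + r) = 0" using i j b by (auto simp: typical_def)
          then show ?thesis using pos i by simp
        qed (use pos b1 in auto)
      qed (use c in simp)
      then show "z (c * k + r) * of_bool (b 0 r < z (c * k + r)) \<le> ?p c r"
        using z(2)[OF j] by auto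
    qed
    moreover have "(\<Sum>r<k. ?p c r) \<le> (\<Sum>c'<k. \<Sum>r<k. ?p c' r)"
      using c p by (intro member_le_sum[where f = "\<lambda>c'. \<Sum>r<k. ?p c' r"] sum_nonneg) auto
    ultimately have "pay (c + 2) ?b \<le> level_gain k (\<lambda>r. z (c * k + r)) (\<lambda>r. b 0 r)"
      unfolding pay_grid grid_val_column level_gain_def by linarith
    then show ?thesis using True by simp
  next
    case False
    then have "\<not> (\<forall>r<k. c * k + r \<in> won ?b (c + 2))" using high by blast
    then have "grid_val k (c + 2) (won ?b (c + 2)) = 0" by (simp add: grid_val_column)
    moreover have "0 \<le> (\<Sum>c'<k. \<Sum>r<k. ?p c' r)" using p by (intro sum_nonneg) auto
    ultimately have "pay (c + 2) ?b \<le> 0" unfolding pay_grid by linarith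
    then show ?thesis using False by (simp only: of_bool_def if_False mult_zero_left)
  qed
qed

section \<open>Pointwise lower bounds on equilibrium profits\<close>

text \<open>Since bidder 0 bids on a single row, the sum over \<open>r\<close> recovers the level
  \<open>t\<close> as an expression in \<open>b 0\<close>. Without nonzero ties, the item of that
  row in column \<open>c\<close> is won exactly when bidder 1's price there is below
  \<open>t\<close>.\<close>

lemma pay_0_bound:
  assumes b: "typical k b" and no_tie: "\<And>j. j < k * k \<Longrightarrow> b 0 j = b 1 j \<Longrightarrow> b 1 j = 0"
  shows "pay 0 b \<ge> level_gain k (\<lambda>_. \<Sum>r<k. b 0 r) (\<lambda>c. b 1 (c * k))"
proof -
  have bs: "b \<in> space (profile_space (k + 2) (k * k))" using b by (simp add: typical_def)
  obtain J t where J: "J < k" "0 < t" "t \<le> 1 / real k"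
    "\<And>c r. c < k \<Longrightarrow> r < k \<Longrightarrow> b 0 (c * k + r) = (if r = J then t else 0)"
    "\<And>r. r < k \<Longrightarrow> b 0 r = (if r = J then t else 0)"
    using typical_row[OF k b] by blast
  obtain C s where C: "C < k" "0 < s" "s \<le> 1 / real k"
    "\<And>c r. c < k \<Longrightarrow> r < k \<Longrightarrow> b 1 (c * k + r) = (if c = C then s else 0)"
    "\<And>c. c < k \<Longrightarrow> b 1 (c * k) = (if c = C then s else 0)"
    using typical_column[OF k b] by blast
  have t: "(\<Sum>r<k. b 0 r) = t" using J by simp
  have iff: "c * k + J \<in> won b 0 \<longleftrightarrow> b 1 (c * k) < t" "b 1 (c * k) \<noteq> t" if c: "c < k" for c
  proof -
    have j: "c * k + J < k * k" using grid_item_less c J(1) by simp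
    have b1: "b 1 (c * k + J) = b 1 (c * k)" "b 0 (c * k + J) = t" using C J c by auto
    then show ne: "b 1 (c * k) \<noteq> t" using no_tie[OF j] J by auto
    show "c * k + J \<in> won b 0 \<longleftrightarrow> b 1 (c * k) < t"
    proof
      assume "c * k + J \<in> won b 0"
      from won_highest[OF bs this, of 1] show "b 1 (c * k) < t" using b1 ne by simp
    next
      assume less: "b 1 (c * k) < t"
      show "c * k + J \<in> won b 0"
      proof (rule wonI[OF bs j])
        fix i assume i: "i < k + 2" "i \<noteq> 0"
        show "b i (c * k + J) < b 0 (c * k + J)"
        proof (cases "i = 1")
          case False
          then have "b i (c * k + J) = 0" using i j b by (auto simp: typical_def)
          then show ?thesis using b1 J by simp
        qed (use b1 less in simp)
      qed simp
    qed
  qed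
  have "(of_bool (\<forall>c<k. b 1 (c * k) \<le> t) :: real) \<le> of_bool (\<forall>c<k. \<exists>r<k. c * k + r \<in> won b 0)"
    using iff J(1) by (auto simp: order.order_iff_strict)
  moreover have "(\<Sum>r<k. b 0 (c * k + r) * of_bool (c * k + r \<in> won b 0))
      = t * of_bool (b 1 (c * k) < t)" if c: "c < k" for c
  proof -
    have "(\<Sum>r<k. b 0 (c * k + r) * of_bool (c * k + r \<in> won b 0))
        = (\<Sum>r<k. if r = J then t * of_bool (b 1 (c * k) < t) else 0)"
      using J c iff(1)[OF c] by (intro sum.cong) auto
    then show ?thesis using J(1) by simp
  qed
  ultimately show ?thesis
    unfolding pay_grid grid_val_0 level_gain_def t by simp
qed

text \<open>The transposed situation: the sum over \<open>c\<close> recovers the level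
  \<open>s\<close>. Items won outside the chosen column \<open>C\<close> cost 0, so the payment
  reduces to column \<open>C\<close>.\<close>

lemma pay_1_bound:
  assumes b: "typical k b" and no_tie: "\<And>j. j < k * k \<Longrightarrow> b 0 j = b 1 j \<Longrightarrow> b 1 j = 0"
  shows "pay 1 b \<ge> level_gain k (\<lambda>_. \<Sum>c<k. b 1 (c * k)) (\<lambda>r. b 0 r)"
proof -
  have bs: "b \<in> space (profile_space (k + 2) (k * k))" using b by (simp add: typical_def)
  obtain J t where J: "J < k" "0 < t" "t \<le> 1 / real k"
    "\<And>c r. c < k \<Longrightarrow> r < k \<Longrightarrow> b 0 (c * k + r) = (if r = J then t else 0)"
    "\<And>r. r < k \<Longrightarrow> b 0 r = (if r = J then t else 0)"
    using typical_row[OF k b] by blast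
  obtain C s where C: "C < k" "0 < s" "s \<le> 1 / real k"
    "\<And>c r. c < k \<Longrightarrow> r < k \<Longrightarrow> b 1 (c * k + r) = (if c = C then s else 0)"
    "\<And>c. c < k \<Longrightarrow> b 1 (c * k) = (if c = C then s else 0)"
    using typical_column[OF k b] by blast
  have s: "(\<Sum>c<k. b 1 (c * k)) = s" using C by simp
  have iff: "C * k + r \<in> won b 1 \<longleftrightarrow> b 0 r < s" "b 0 r \<noteq> s" if r: "r < k" for r
  proof -
    have j: "C * k + r < k * k" using grid_item_less r C(1) by simp
    have b0: "b 0 (C * k + r) = b 0 r" "b 1 (C * k + r) = s" using C J r by auto
    then show ne: "b 0 r \<noteq> s" using no_tie[OF j] C by auto
    show "C * k + r \<in> won b 1 \<longleftrightarrow> b 0 r < s"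
    proof
      assume "C * k + r \<in> won b 1"
      from won_highest[OF bs this, of 0] show "b 0 r < s" using b0 ne by simp
    next
      assume less: "b 0 r < s"
      show "C * k + r \<in> won b 1"
      proof (rule wonI[OF bs j])
        fix i assume i: "i < k + 2" "i \<noteq> 1"
        show "b i (C * k + r) < b 1 (C * k + r)"
        proof (cases "i = 0")
          case False
          then have "b i (C * k + r) = 0" using i j b by (auto simp: typical_def)
          then show ?thesis using b0 C by simp
        qed (use b0 less in simp)
      qed simp
    qed
  qed
  have "(of_bool (\<forall>r<k. b 0 r \<le> s) :: real) \<le> of_bool (\<exists>c<k. \<forall>r<k. c * k + r \<in> won b 1)"
  proof (cases "\<forall>r<k. b 0 r \<le> s")
    case True
    then have "\<forall>r<k. C * k + r \<in> won b 1" using iff by (auto simp: order.order_iff_strict)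
    then show ?thesis using C(1) by auto
  next
    case False
    then show ?thesis by (simp only: of_bool_def if_False) simp
  qed
  moreover have "(\<Sum>c<k. \<Sum>r<k. b 1 (c * k + r) * of_bool (c * k + r \<in> won b 1))
      = (\<Sum>r<k. s * of_bool (b 0 r < s))"
  proof -
    have "(\<Sum>r<k. b 1 (c * k + r) * of_bool (c * k + r \<in> won b 1))
        = (if c = C then \<Sum>r<k. s * of_bool (b 0 r < s) else 0)" if c: "c < k" for c
    proof (cases "c = C")
      case True
      have "(\<Sum>r<k. b 1 (c * k + r) * of_bool (c * k + r \<in> won b 1))
          = (\<Sum>r<k. s * of_bool (b 0 r < s))"
      proof (rule sum.cong[OF refl])
        fix r assume "r \<in> {..<k}"
        then have r: "r < k" by simp
        show "b 1 (c * k + r) * of_bool (c * k + r \<in> won b 1) = s * of_bool (b 0 r < s)"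
          using C(4)[OF c r] iff(1)[OF r] True by simp
      qed
      then show ?thesis using True by simp
    next
      case False
      have "(\<Sum>r<k. b 1 (c * k + r) * of_bool (c * k + r \<in> won b 1)) = 0"
        using C(4)[OF c] False by (intro sum.neutral) simp
      then show ?thesis using False by simp
    qed
    then have "(\<Sum>c<k. \<Sum>r<k. b 1 (c * k + r) * of_bool (c * k + r \<in> won b 1))
        = (\<Sum>c<k. if c = C then \<Sum>r<k. s * of_bool (b 0 r < s) else 0)"
      by (intro sum.cong[OF refl]) simp
    also have "\<dots> = (\<Sum>r<k. s * of_bool (b 0 r < s))"
      using C(1) by (subst sum.delta) simp_all
    finally show ?thesis .
  qed
  ultimately show ?thesis
    unfolding pay_grid grid_val_1 level_gain_def s by simp
qed

text \<open>Every column meets the row on which bidder 0 bids a positive amount, so no idle bidder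
  wins its column. Bidders 0 and 1 cannot both succeed, since a column won entirely by bidder 1
  contains no item of bidder 0.\<close>

lemma welfare_le_1:
  assumes b: "typical k b"
  shows "welfare (k + 2) (k * k) (grid_val k) (w b) \<le> 1"
proof -
  have bs: "b \<in> space (profile_space (k + 2) (k * k))" using b by (simp add: typical_def)
  obtain J t where J: "J < k" "0 < t" "t \<le> 1 / real k"
    "\<And>c r. c < k \<Longrightarrow> r < k \<Longrightarrow> b 0 (c * k + r) = (if r = J then t else 0)"
    "\<And>r. r < k \<Longrightarrow> b 0 r = (if r = J then t else 0)"
    using typical_row[OF k b] by blast
  have "grid_val k (c + 2) (won b (c + 2)) = 0" if c: "c < k" for c
  proof -
    have "c * k + J \<notin> won b (c + 2)"
    proof
      assume "c * k + J \<in> won b (c + 2)"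
      from won_highest[OF bs this, of 0] have "t \<le> b (c + 2) (c * k + J)" using J c by simp
      moreover have "b (c + 2) (c * k + J) = 0"
        using b c grid_item_less[OF c J(1)] by (auto simp: typical_def)
      ultimately show False using J by simp
    qed
    then show ?thesis using J(1) by (auto simp: grid_val_column)
  qed
  then have "welfare (k + 2) (k * k) (grid_val k) (w b)
      = grid_val k 0 (won b 0) + grid_val k 1 (won b 1)"
    by (simp add: welfare_def add_2_eq_Suc' sum.lessThan_Suc_shift del: sum.lessThan_Suc)
  also have "\<dots> \<le> 1"
  proof (rule ccontr)
    assume "\<not> ?thesis"
    then have "grid_val k 0 (won b 0) \<noteq> 0" "grid_val k 1 (won b 1) \<noteq> 0"
      using grid_val_bounds(2)[of k 0 "won b 0"] grid_val_bounds(2)[of k 1 "won b 1"] by auto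
    then have v: "\<forall>c<k. \<exists>r<k. c * k + r \<in> won b 0" "\<exists>c<k. \<forall>r<k. c * k + r \<in> won b 1"
      unfolding grid_val_0 grid_val_1 by auto
    then obtain c where c: "c < k" "\<And>r. r < k \<Longrightarrow> c * k + r \<in> won b 1" by blast
    from v(1) c obtain r where "r < k" "c * k + r \<in> won b 0" by blast
    with c(2)[of r] show False by (simp add: bundle_of_def)
  qed
  finally show ?thesis .
qed

lemma typical_bid_bounds:
  assumes b: "typical k b" and i: "i < k + 2" and j: "j < k * k"
  shows "0 \<le> b i j" "b i j \<le> 1"
proof -
  have k1: "1 / real k \<le> 1" using k by simp
  have cb: "0 \<le> \<beta> j \<and> \<beta> j \<le> 1" if "class_bid k \<kappa> \<beta>" for \<kappa> \<beta>
  proof -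
    from that obtain J t where t: "0 < t" "t \<le> 1 / real k"
      and "\<forall>j<k * k. \<beta> j = (if \<kappa> j = J then t else 0)"
      unfolding class_bid_def by blast
    then have "\<beta> j = (if \<kappa> j = J then t else 0)" using j by blast
    then show ?thesis using k1 t by auto
  qed
  consider "i = 0" | "i = 1" | "i \<ge> 2" by linarith
  then have "0 \<le> b i j \<and> b i j \<le> 1"
  proof cases
    case 3
    then show ?thesis using b i j by (simp add: typical_def)
  qed (use b cb in \<open>auto simp: typical_def\<close>)
  then show "0 \<le> b i j" "b i j \<le> 1" by auto
qed

section \<open>Measurability and integrability\<close>

text \<open>The bundle takes values in a finite set, and each of its fibers is a finite conjunction
  of measurable conditions on \<open>w\<close>; hence every real function of it is
  measurable.\<close>

lemma won_measurable: "(\<lambda>b. h (won b i)) \<in> borel_measurable (play k)" for h :: "nat set \<Rightarrow> real"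
proof -
  have w: "Measurable.pred (play k) (\<lambda>b. w b j = i)" if "j < k * k" for j
  proof -
    have "(\<lambda>b. w b j) \<in> profile_space (k + 2) (k * k) \<rightarrow>\<^sub>M count_space UNIV"
      using rule that by (simp add: highest_bid_rule_def)
    then have "(\<lambda>b. w b j) \<in> play k \<rightarrow>\<^sub>M count_space UNIV"
      using measurable_cong_sets[OF sets_play[OF k] refl] by blast
    then show ?thesis by (rule measurable_compose) simp
  qed
  have "(\<lambda>b. won b i) \<in> play k \<rightarrow>\<^sub>M count_space (Pow {..<k * k})"
  proof (subst measurable_count_space_eq2, simp, intro conjI ballI)
    show "(\<lambda>b. won b i) \<in> space (play k) \<rightarrow> Pow {..<k * k}" by (auto simp: bundle_of_def)
    fix S assume S: "S \<in> Pow {..<k * k}"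
    have "(\<lambda>b. won b i) -` {S} \<inter> space (play k)
        = {b \<in> space (play k). \<forall>j\<in>{..<k * k}. (w b j = i) = (j \<in> S)}"
      using S by (auto simp: bundle_of_def)
    also have "\<dots> \<in> sets (play k)"
      unfolding pred_def[symmetric]
    proof (rule pred_intros_finite)
      fix j assume "j \<in> {..<k * k}"
      then show "Measurable.pred (play k) (\<lambda>b. (w b j = i) = (j \<in> S))"
        using w[of j] by (cases "j \<in> S") (auto intro: pred_intros_logic)
    qed simp
    finally show "(\<lambda>b. won b i) -` {S} \<inter> space (play k) \<in> sets (play k)" .
  qed
  then show ?thesis by (rule measurable_compose) simp
qed

lemma integrable_pay:
  assumes i: "i < k + 2"
  shows "integrable (play k) (pay i)"
proof -
  interpret prob_space "play k" by (rule prob_space_play[OF k])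
  \<comment> \<open>The value contributes at most 1 to the bound, and each of the
    \<open>k * k\<close> items at most 1 in payments.\<close>
  show ?thesis
  proof (rule integrable_const_bound[where B = "1 + real k * real k"])
    show "AE b in play k. norm (pay i b) \<le> 1 + real k * real k"
      using AE_typical[OF k]
    proof eventually_elim
      case (elim b)
      have bd: "0 \<le> b i (c * k + r) * of_bool (c * k + r \<in> won b i)
          \<and> b i (c * k + r) * of_bool (c * k + r \<in> won b i) \<le> 1" if "c < k" "r < k" for c r
        using typical_bid_bounds[OF elim i grid_item_less[OF that]] by auto
      have "0 \<le> (\<Sum>c<k. \<Sum>r<k. b i (c * k + r) * of_bool (c * k + r \<in> won b i))"
        using bd by (intro sum_nonneg) auto
      moreover have "(\<Sum>c<k. \<Sum>r<k. b i (c * k + r) * of_bool (c * k + r \<in> won b i))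
          \<le> (\<Sum>c<k. \<Sum>r<k. 1)"
        using bd by (intro sum_mono) auto
      ultimately show ?case
        using grid_val_bounds[of k i "won b i"] unfolding pay_grid by (simp add: abs_le_iff)
    qed
    have "(\<lambda>b. b i (c * k + r) * of_bool (c * k + r \<in> won b i)) \<in> borel_measurable (play k)"
      if "c < k" "r < k" for c r
      using won_measurable[of "\<lambda>S. of_bool (c * k + r \<in> S)" i]
        bid_measurable[OF k i grid_item_less[OF that]]
      by (intro borel_measurable_times)
    then show "pay i \<in> borel_measurable (play k)"
      unfolding pay_grid[abs_def] using won_measurable[of "grid_val k i" i]
      by (intro borel_measurable_diff borel_measurable_sum) auto
  qed
qed

lemma integrable_bounded_play:
  assumes "f \<in> borel_measurable (play k)" "AE b in play k. \<bar>f b\<bar> \<le> (B::real)"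
  shows "integrable (play k) f"
proof -
  interpret prob_space "play k" by (rule prob_space_play[OF k])
  show ?thesis using assms by (intro integrable_const_bound[where B = B]) auto
qed

section \<open>Expected profits from deviations\<close>

lemma deviation_0_nonpos:
  assumes z: "z \<in> space (bid_space (k * k))" "\<And>j. j < k * k \<Longrightarrow> 0 \<le> z j"
  shows "(\<integral>b. pay 0 (b(0 := z)) \<partial>play k) \<le> 0"
proof (rule integral_nonpos_AE_bound)
  let ?Z = "\<lambda>c. Max ((\<lambda>r. z (c * k + r)) ` {..<k})"
  let ?G = "\<lambda>y x. level_gain k ?Z (\<lambda>c. y (c * k))" and ?g = "\<lambda>b. level_gain k ?Z (\<lambda>c. b 1 (c * k))"
  have Z: "0 \<le> ?Z c" if "c < k" for c
  proof -
    have "0 \<le> z (c * k + 0)" using z(2) that by simp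
    also have "\<dots> \<le> ?Z c" using k by (intro Max_ge) (auto intro!: rev_image_eqI[of 0])
    finally show ?thesis .
  qed
  show "AE b in play k. pay 0 (b(0 := z)) \<le> ?g b"
    using AE_typical[OF k] by eventually_elim (rule deviation_0_bound[OF _ z])
  show int: "integrable (play k) ?g"
  proof (rule integrable_bounded_play)
    show "?g \<in> borel_measurable (play k)"
      by (intro level_gain_measurable bid_measurable[OF k]) auto
    show "AE b in play k. \<bar>?g b\<bar> \<le> 1 + (\<Sum>c<k. ?Z c)"
      using Z by (intro AE_I2 abs_level_gain_le)
  qed
  \<comment> \<open>\<open>?G\<close> ignores \<open>x\<close>: bidder 0's own random bid has been
    replaced by \<open>z\<close>, so only bidder 1's randomness counts.\<close>
  have "AE x in grid_strategy k 0. (\<integral>y. ?G y x \<partial>grid_strategy k 1) \<le> 0"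
    using level_gain_column_nonpos[OF k Z] by simp
  then show "(\<integral>b. ?g b \<partial>play k) \<le> 0"
    using int by (intro integral_PiM_pair_nonpos[where G = ?G and i = 1 and j = 0]
        prob_space_grid_strategy[OF k]) auto
qed

lemma deviation_1_nonpos:
  assumes z: "z \<in> space (bid_space (k * k))" "\<And>j. j < k * k \<Longrightarrow> 0 \<le> z j"
  shows "(\<integral>b. pay 1 (b(1 := z)) \<partial>play k) \<le> 0"
proof (rule integral_nonpos_AE_bound)
  let ?g = "\<lambda>b. \<Sum>c<k. level_gain k (\<lambda>r. z (c * k + r)) (\<lambda>r. b 0 r)"
  have Z: "0 \<le> z (c * k + r)" if "c < k" "r < k" for c r
    using z(2) grid_item_less that by simp
  show "AE b in play k. pay 1 (b(1 := z)) \<le> ?g b"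
    using AE_typical[OF k] by eventually_elim (rule deviation_1_bound[OF _ z])
  have int: "integrable (play k) (\<lambda>b. level_gain k (\<lambda>r. z (c * k + r)) (\<lambda>r. b 0 r))"
    if c: "c < k" for c
  proof (rule integrable_bounded_play)
    show "(\<lambda>b. level_gain k (\<lambda>r. z (c * k + r)) (\<lambda>r. b 0 r)) \<in> borel_measurable (play k)"
      using row_rep[OF k] by (intro level_gain_measurable bid_measurable[OF k]) auto
    show "AE b in play k. \<bar>level_gain k (\<lambda>r. z (c * k + r)) (\<lambda>r. b 0 r)\<bar>
        \<le> 1 + (\<Sum>r<k. z (c * k + r))"
      using Z c by (intro AE_I2 abs_level_gain_le)
  qed
  then show "integrable (play k) ?g" by (intro Bochner_Integration.integrable_sum) auto
  have "(\<integral>b. level_gain k (\<lambda>r. z (c * k + r)) (\<lambda>r. b 0 r) \<partial>play k) \<le> 0" if c: "c < k" for c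
  proof -
    let ?G = "\<lambda>y x. level_gain k (\<lambda>r. z (c * k + r)) (\<lambda>r. y r)"
    have "AE x in grid_strategy k 1. (\<integral>y. ?G y x \<partial>grid_strategy k 0) \<le> 0"
      using level_gain_row_nonpos[OF k Z[OF c]] by simp
    then show ?thesis
      using int[OF c] by (intro integral_PiM_pair_nonpos[where G = ?G and i = 0 and j = 1]
          prob_space_grid_strategy[OF k]) auto
  qed
  then show "(\<integral>b. ?g b \<partial>play k) \<le> 0"
    using int by (subst Bochner_Integration.integral_sum) (auto intro!: sum_nonpos)
qed

text \<open>Given bidder 1's bids, the indicator in the majorant is fixed and the gain against
  bidder 0 has nonpositive mean. The majorant holds almost surely because bidder 1's bids tie with a
  nonzero entry of the fixed vector \<open>z\<close> with probability 0.\<close>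

lemma deviation_column_nonpos:
  assumes z: "z \<in> space (bid_space (k * k))" "\<And>j. j < k * k \<Longrightarrow> 0 \<le> z j" and c: "c < k"
  shows "(\<integral>b. pay (c + 2) (b(c + 2 := z)) \<partial>play k) \<le> 0"
proof (rule integral_nonpos_AE_bound)
  let ?G = "\<lambda>y x. of_bool (\<forall>r\<in>{..<k}. x (c * k + r) \<le> z (c * k + r))
    * level_gain k (\<lambda>r. z (c * k + r)) (\<lambda>r. y r)"
  let ?g = "\<lambda>b. ?G (b 0) (b 1)"
  have Z: "0 \<le> z (c * k + r)" if "r < k" for r
    using z(2) grid_item_less c that by simp
  have "AE b in play k. \<forall>j\<in>{..<k * k}. b 1 j = z j \<longrightarrow> z j = 0"
  proof (rule AE_ball_countable')
    fix j assume "j \<in> {..<k * k}"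
    then have "AE \<beta> in grid_strategy k 1. \<beta> j = z j \<longrightarrow> z j = 0"
      unfolding grid_strategy_1 by (intro AE_class_strategy_neq[OF k]) simp
    from AE_play_component[OF k _ this] show "AE b in play k. b 1 j = z j \<longrightarrow> z j = 0" by simp
  qed simp
  then show "AE b in play k. pay (c + 2) (b(c + 2 := z)) \<le> ?g b"
    using AE_typical[OF k]
  proof eventually_elim
    case (elim b)
    then show ?case using deviation_column_bound[OF _ z c, of b] by (simp add: Ball_def)
  qed
  show int: "integrable (play k) ?g"
  proof (rule integrable_bounded_play)
    have "Measurable.pred (play k) (\<lambda>b. \<forall>r\<in>{..<k}. b 1 (c * k + r) \<le> z (c * k + r))"
    proof (intro pred_intros_finite)
      fix r assume "r \<in> {..<k}"
      then show "Measurable.pred (play k) (\<lambda>b. b 1 (c * k + r) \<le> z (c * k + r))"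
        using grid_item_less[OF c] unfolding pred_def
        by (intro borel_measurable_le bid_measurable[OF k] borel_measurable_const) auto
    qed simp
    then show "?g \<in> borel_measurable (play k)"
      using row_rep[OF k]
      by (intro borel_measurable_times measurable_compose[OF _ measurable_of_bool]
          level_gain_measurable bid_measurable[OF k]) auto
    have "\<bar>?g b\<bar> \<le> 1 + (\<Sum>r<k. z (c * k + r))" for b
    proof -
      have "\<bar>?g b\<bar> \<le> \<bar>level_gain k (\<lambda>r. z (c * k + r)) (\<lambda>r. b 0 r)\<bar>"
        by (auto simp: of_bool_def)
      also have "\<dots> \<le> 1 + (\<Sum>r<k. z (c * k + r))" using Z by (rule abs_level_gain_le)
      finally show ?thesis .
    qed
    then show "AE b in play k. \<bar>?g b\<bar> \<le> 1 + (\<Sum>r<k. z (c * k + r))" by (rule AE_I2)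
  qed
  have "AE x in grid_strategy k 1. (\<integral>y. ?G y x \<partial>grid_strategy k 0) \<le> 0"
    using level_gain_row_nonpos[OF k Z] by (simp add: of_bool_def)
  then show "(\<integral>b. ?g b \<partial>play k) \<le> 0"
    using int by (intro integral_PiM_pair_nonpos[where G = ?G and i = 0 and j = 1]
        prob_space_grid_strategy[OF k]) auto
qed

section \<open>Expected profits in the profile\<close>

lemma class_bid_level:
  assumes "class_bid k \<kappa> \<beta>" and rep: "\<And>c. c < k \<Longrightarrow> \<rho> c < k * k \<and> \<kappa> (\<rho> c) = c"
  shows "0 \<le> (\<Sum>c<k. \<beta> (\<rho> c))" "(\<Sum>c<k. \<beta> (\<rho> c)) \<le> 1 / real k"
proof -
  obtain J t where J: "J < k" "0 < t" "t \<le> 1 / real k"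
    and \<beta>: "\<And>j. j < k * k \<Longrightarrow> \<beta> j = (if \<kappa> j = J then t else 0)"
    using assms(1) by (auto simp: class_bid_def)
  have "(\<Sum>c<k. \<beta> (\<rho> c)) = (\<Sum>c<k. if c = J then t else 0)"
    using \<beta> rep by (intro sum.cong) auto
  then show "0 \<le> (\<Sum>c<k. \<beta> (\<rho> c))" "(\<Sum>c<k. \<beta> (\<rho> c)) \<le> 1 / real k" using J by auto
qed

lemma row_level:
  assumes "class_bid k (\<lambda>j. j mod k) \<beta>"
  shows "0 \<le> (\<Sum>r<k. \<beta> r)" "(\<Sum>r<k. \<beta> r) \<le> 1 / real k"
  using class_bid_level[OF assms, of "\<lambda>r. r"] row_rep[OF k] by auto

lemma column_level:
  assumes "class_bid k (\<lambda>j. j div k) \<beta>"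
  shows "0 \<le> (\<Sum>c<k. \<beta> (c * k))" "(\<Sum>c<k. \<beta> (c * k)) \<le> 1 / real k"
  using class_bid_level[OF assms, of "\<lambda>c. c * k"] column_rep[OF k] by auto

lemma abs_level_gain_constant:
  assumes "0 \<le> t" "t \<le> 1 / real k"
  shows "\<bar>level_gain k (\<lambda>_. t) l\<bar> \<le> 2"
proof -
  have "\<bar>level_gain k (\<lambda>_. t) l\<bar> \<le> 1 + (\<Sum>c<k. t)" using assms by (intro abs_level_gain_le)
  also have "(\<Sum>c<k. t) \<le> 1" using assms k by (simp add: field_simps)
  finally show ?thesis by simp
qed

text \<open>Conditionally on bidder 0's own level, which lies in \<open>[0, 1/k]\<close>, the gain
  against bidder 1's random column has mean 0 by \<open>level_gain_zero\<close>. The lower bound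
  \<open>?g\<close> is negated in \<open>?G\<close> because \<open>integral_PiM_pair_nonpos\<close>
  provides upper bounds.\<close>

lemma pay_0_nonneg: "0 \<le> (\<integral>b. pay 0 b \<partial>play k)"
proof -
  let ?G = "\<lambda>y x. - level_gain k (\<lambda>_. \<Sum>r<k. x r) (\<lambda>c. y (c * k))"
  let ?g = "\<lambda>b. level_gain k (\<lambda>_. \<Sum>r<k. b 0 r) (\<lambda>c. b 1 (c * k))"
  have int: "integrable (play k) ?g"
  proof (rule integrable_bounded_play)
    show "?g \<in> borel_measurable (play k)"
      using row_rep[OF k]
      by (intro level_gain_measurable borel_measurable_sum bid_measurable[OF k]) auto
    show "AE b in play k. \<bar>?g b\<bar> \<le> 2"
      using AE_typical[OF k]
    proof eventually_elim
      case (elim b)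
      then have "class_bid k (\<lambda>j. j mod k) (b 0)" by (simp add: typical_def)
      from row_level[OF this] show ?case by (intro abs_level_gain_constant)
    qed
  qed
  have "AE x in grid_strategy k 0. (\<integral>y. ?G y x \<partial>grid_strategy k 1) \<le> 0"
    using AE_class_bid_row[OF k]
  proof eventually_elim
    case (elim x)
    from level_gain_zero(2)[OF k row_level[OF elim]] show ?case by simp
  qed
  then have "(\<integral>b. - ?g b \<partial>play k) \<le> 0"
    using int by (intro integral_PiM_pair_nonpos[where G = ?G and i = 1 and j = 0]
        prob_space_grid_strategy[OF k]) auto
  then have "0 \<le> (\<integral>b. ?g b \<partial>play k)" by simp
  also have "\<dots> \<le> (\<integral>b. pay 0 b \<partial>play k)"
  proof (rule integral_mono_AE[OF int integrable_pay])
    show "AE b in play k. ?g b \<le> pay 0 b"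
      using AE_typical[OF k] AE_no_tie[OF k] by eventually_elim (intro pay_0_bound, auto)
  qed simp
  finally show ?thesis .
qed

lemma pay_1_nonneg: "0 \<le> (\<integral>b. pay 1 b \<partial>play k)"
proof -
  let ?G = "\<lambda>y x. - level_gain k (\<lambda>_. \<Sum>c<k. x (c * k)) (\<lambda>r. y r)"
  let ?g = "\<lambda>b. level_gain k (\<lambda>_. \<Sum>c<k. b 1 (c * k)) (\<lambda>r. b 0 r)"
  have int: "integrable (play k) ?g"
  proof (rule integrable_bounded_play)
    show "?g \<in> borel_measurable (play k)"
      using row_rep[OF k]
      by (intro level_gain_measurable borel_measurable_sum bid_measurable[OF k]) auto
    show "AE b in play k. \<bar>?g b\<bar> \<le> 2"
      using AE_typical[OF k]
    proof eventually_elim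
      case (elim b)
      then have "class_bid k (\<lambda>j. j div k) (b 1)" by (simp add: typical_def)
      from column_level[OF this] show ?case by (intro abs_level_gain_constant)
    qed
  qed
  have "AE x in grid_strategy k 1. (\<integral>y. ?G y x \<partial>grid_strategy k 0) \<le> 0"
    using AE_class_bid_column[OF k]
  proof eventually_elim
    case (elim x)
    from level_gain_zero(1)[OF k column_level[OF elim]] show ?case by simp
  qed
  then have "(\<integral>b. - ?g b \<partial>play k) \<le> 0"
    using int by (intro integral_PiM_pair_nonpos[where G = ?G and i = 0 and j = 1]
        prob_space_grid_strategy[OF k]) auto
  then have "0 \<le> (\<integral>b. ?g b \<partial>play k)" by simp
  also have "\<dots> \<le> (\<integral>b. pay 1 b \<partial>play k)"
  proof (rule integral_mono_AE[OF int integrable_pay])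
    show "AE b in play k. ?g b \<le> pay 1 b"
      using AE_typical[OF k] AE_no_tie[OF k] by eventually_elim (intro pay_1_bound, auto)
  qed simp
  finally show ?thesis .
qed

lemma pay_idle_nonneg:
  assumes "2 \<le> i" "i < k + 2"
  shows "0 \<le> (\<integral>b. pay i b \<partial>play k)"
proof (rule integral_nonneg_AE)
  show "AE b in play k. 0 \<le> pay i b"
    using AE_typical[OF k]
  proof eventually_elim
    case (elim b)
    have "b i (c * k + r) = 0" if "c < k" "r < k" for c r
      using elim assms grid_item_less[OF that] by (simp add: typical_def)
    then show ?case using grid_val_bounds(1)[of k i "won b i"] by (simp add: pay_grid)
  qed
qed

text \<open>No deviation has positive expected utility, while every bidder's expected utility in the
  profile is nonnegative.\<close>

lemma grid_equilibrium: "nash_equilibrium (k + 2) (k * k) (grid_val k) w (grid_strategy k)"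
  unfolding nash_equilibrium_def
proof (intro conjI allI impI ballI)
  fix i assume i: "i < k + 2"
  show "integrable (play k) (pay i)" by (rule integrable_pay[OF i])
  show "mixed_strategy (k * k) (grid_strategy k i)"
    unfolding mixed_strategy_def
  proof (intro conjI prob_space_grid_strategy[OF k] sets_grid_strategy[OF k])
    have nonneg: "\<forall>j<k * k. 0 \<le> \<beta> j" if "class_bid k \<kappa> \<beta>" for \<kappa> \<beta>
      using that by (auto simp: class_bid_def)
    consider "i = 0" | "i = 1" | "i \<ge> 2" by linarith
    then show "AE x in grid_strategy k i. \<forall>j<k * k. 0 \<le> x j"
    proof cases
      case 1
      show ?thesis unfolding 1 using AE_class_bid_row[OF k]
        by eventually_elim (rule nonneg)
    next
      case 2
      show ?thesis unfolding 2 using AE_class_bid_column[OF k]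
        by eventually_elim (rule nonneg)
    next
      case 3
      show ?thesis using AE_grid_strategy_idle[OF k 3] by eventually_elim auto
    qed
  qed
  fix x assume x: "x \<in> space (bid_space (k * k))" "\<forall>j<k * k. 0 \<le> x j"
  consider "i = 0" | "i = 1" | "i \<ge> 2" by linarith
  then show "(\<integral>b. pay i (b(i := x)) \<partial>play k) \<le> (\<integral>b. pay i b \<partial>play k)"
  proof cases
    case 1
    then show ?thesis using deviation_0_nonpos[of x] pay_0_nonneg x by fastforce
  next
    case 2
    then show ?thesis using deviation_1_nonpos[of x] pay_1_nonneg x by fastforce
  next
    case 3
    then obtain c where c: "i = c + 2" "c < k"
      using i by (metis add.commute add_less_cancel_right le_Suc_ex)
    show ?thesis using deviation_column_nonpos[of x c] pay_idle_nonneg[OF 3 i] x c by fastforce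
  qed
qed

lemma grid_expected_welfare_le: "expected_welfare (k + 2) (k * k) (grid_val k) w (grid_strategy k) \<le> 1"
proof -
  interpret prob_space "play k" by (rule prob_space_play[OF k])
  have "AE b in play k. welfare (k + 2) (k * k) (grid_val k) (w b) \<le> 1"
    using AE_typical[OF k] by eventually_elim (rule welfare_le_1)
  \<comment> \<open>In the non-integrable case the integral is 0, which also satisfies the
    bound.\<close>
  then show ?thesis unfolding expected_welfare_def
    by (cases "integrable (play k) (\<lambda>b. welfare (k + 2) (k * k) (grid_val k) (w b))")
      (auto intro: integral_le_const simp: not_integrable_integral_eq)
qed

end

section \<open>Optimal welfare and the ratio\<close>

lemma grid_optimal_welfare_ge:
  assumes k: "k \<ge> 2"
  shows "real k \<le> optimal_welfare (k + 2) (k * k) (grid_val k)"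
proof -
  define a where "a = (\<lambda>j\<in>{..<k * k}. j div k + 2)"
  have "j div k < k" if "j < k * k" for j
    using that by (simp add: less_mult_imp_div_less)
  then have a: "a \<in> {..<k * k} \<rightarrow>\<^sub>E {..<k + 2}" by (auto simp: a_def)
  have val: "grid_val k (c + 2) (bundle_of (k * k) a (c + 2)) = 1" if c: "c < k" for c
    using grid_item_less[OF c] by (simp add: grid_val_column bundle_of_def a_def)
  have "real k = (\<Sum>c<k. grid_val k (c + 2) (bundle_of (k * k) a (c + 2)))"
    using val by simp
  also have "\<dots> \<le> welfare (k + 2) (k * k) (grid_val k) a"
    using grid_val_bounds(1) unfolding welfare_def add_2_eq_Suc'
    by (simp add: sum.lessThan_Suc_shift del: sum.lessThan_Suc)
  also have "\<dots> \<le> optimal_welfare (k + 2) (k * k) (grid_val k)"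
    unfolding optimal_welfare_def using a by (intro Max_ge finite_imageI finite_PiE) auto
  finally show ?thesis .
qed

lemma grid_price_of_anarchy_ge:
  assumes k: "k \<ge> 2" and rule: "highest_bid_rule (k + 2) (k * k) w"
  shows "price_of_anarchy (k + 2) (k * k) (grid_val k) w \<ge> ereal (real k)"
proof -
  define I where "I = (INF \<sigma> \<in> {\<sigma>. nash_equilibrium (k + 2) (k * k) (grid_val k) w \<sigma>}.
    ereal (expected_welfare (k + 2) (k * k) (grid_val k) w \<sigma>))"
  have "I \<le> ereal (expected_welfare (k + 2) (k * k) (grid_val k) w (grid_strategy k))"
    unfolding I_def using grid_equilibrium[OF k rule] by (intro INF_lower) simp
  also have "\<dots> \<le> 1" using grid_expected_welfare_le[OF k rule] by simp
  finally have "I \<le> 1" .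
  moreover have "0 \<le> I"
    unfolding I_def expected_welfare_def welfare_def
    by (intro INF_greatest) (auto intro!: integral_nonneg_AE sum_nonneg grid_val_bounds)
  \<comment> \<open>The infimum lies in \<open>[0, 1]\<close>, hence is a real number, and the
    division can be done in the reals unless it is 0.\<close>
  ultimately obtain q where q: "I = ereal q" "0 \<le> q" "q \<le> 1" by (cases I) auto
  have opt: "real k \<le> optimal_welfare (k + 2) (k * k) (grid_val k)" (is "_ \<le> ?o")
    by (rule grid_optimal_welfare_ge[OF k])
  have "ereal (real k) \<le> ereal ?o / I"
  proof (cases "q = 0")
    \<comment> \<open>A positive optimum divided by 0 is infinite in \<open>ereal\<close>.\<close>
    case True
    then show ?thesis using opt k q by simp
  next
    case False
    have "real k * q \<le> real k" using q by (simp add: mult_left_le)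
    then show ?thesis using opt q False by (simp add: pos_le_divide_eq)
  qed
  then show ?thesis by (simp add: price_of_anarchy_def I_def)
qed

theorem theorem17:
  fixes d :: nat
  assumes "d > 0"
  shows "\<exists>n m v. n > 0 \<and> (\<forall>i<n. v i \<in> SAW_class m d) \<and>
    (\<forall>w. highest_bid_rule n m w \<longrightarrow>
      price_of_anarchy n m v w \<ge> ereal (real d + 1 / (real d + 1)))"
proof (intro exI conjI allI impI)
  let ?k = "Suc d"
  show "0 < ?k + 2" by simp
  show "grid_val ?k i \<in> SAW_class (?k * ?k) d" for i by (rule grid_val_SAW_class)
  fix w assume "highest_bid_rule (?k + 2) (?k * ?k) w"
  with assms have "price_of_anarchy (?k + 2) (?k * ?k) (grid_val ?k) w \<ge> ereal (real ?k)"
    by (intro grid_price_of_anarchy_ge) auto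
  \<comment> \<open>The grid yields the ratio \<open>d + 1\<close>, which dominates the claimed
    bound because \<open>1 / (d + 1) \<le> 1\<close>.\<close>
  moreover have "real d + 1 / (real d + 1) \<le> real ?k" by simp
  ultimately show "price_of_anarchy (?k + 2) (?k * ?k) (grid_val ?k) w
      \<ge> ereal (real d + 1 / (real d + 1))"
    by (meson ereal_less_eq(3) order_trans)
qed

end
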